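(* Let $V_+,V_-\in\mathbb{C}$ be such that $\mathrm{Im}\,V_+\ne\mathrm{Im}\,V_-$, and let $\mathcal{L}$ be the operator on $L^2(\mathbb{R})$ with $\mathrm{Dom}(\mathcal{L})=H^2(\mathbb{R})$, $\mathcal{L}u=-u''+Vu$, where $V(x)=V_+$ for $x\ge0$ and $V(x)=V_-$ for $x<0$. For each $z\in\rho(\mathcal{L})$ define $$\Psi_z(x)=\left(n_1(z)e^{k_-(z)x}+n_2(z)e^{\overline{k_-(z)}x}\right)\mathbf{1}_{\mathbb{R}_-}(x)+\left(p_1(z)e^{-k_+(z)x}+p_2(z)e^{-\overline{k_+(z)}x}\right)\mathbf{1}_{\mathbb{R}_+}(x),$$ where $$\begin{aligned} n_1(z)&=\frac{k_+(z)+\overline{k_-(z)}}{k_+(z)+k_-(z)}|\mathrm{Im}\,V_+-\mathrm{Im}\,z|+\frac{k_+(z)-\overline{k_+(z)}}{k_+(z)+k_-(z)}|\mathrm{Im}\,V_--\mathrm{Im}\,z|,\\ p_1(z)&=-\frac{k_-(z)-\overline{k_-(z)}}{k_+(z)+k_-(z)}|\mathrm{Im}\,V_+-\mathrm{Im}\,z|-\frac{\overline{k_+(z)}+k_-(z)}{k_+(z)+k_-(z)}|\mathrm{Im}\,V_--\mathrm{Im}\,z|,\\ n_2(z)&=-|\mathrm{Im}\,V_+-\mathrm{Im}\,z|,\\ p_2(z)&=|\mathrm{Im}\,V_--\mathrm{Im}\,z|. \end{aligned}$$ Then $\Psi_z\in H^2(\mathbb{R})$ for all $z\in\rho(\mathcal{L})$,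 and $$\frac{\|(\mathcal{L}-z)\Psi_z\|}{\|\Psi_z\|}=\frac{|V_+-V_-|}{2|\mathrm{Im}\,V_+-\mathrm{Im}\,V_-|}\,\frac{|\mathrm{Im}\,V_+-\mathrm{Im}\,z|\,|\mathrm{Im}\,V_--\mathrm{Im}\,z|}{\mathrm{Re}\,z}\left(1+\mathcal{O}\left(\frac{1}{|\mathrm{Re}\,z|}\right)\right)$$ as $\mathrm{Re}\,z\to+\infty$, uniformly for all $\mathrm{Im}\,z\in|(\mathrm{Im}\,V_+,\mathrm{Im}\,V_-)|$.
   Context: $k_\pm(z):=\sqrt{V_\pm-z}$ with the principal branch of the square root (holomorphic on $\mathbb{C}\setminus(-\infty,0]$, positive on $(0,+\infty)$). $\rho(\mathcal{L})$ is the resolvent set; $\mathbb{R}_+=(0,+\infty)$, $\mathbb{R}_-=(-\infty,0)$; $\mathbf{1}_E$ is the indicator function of $E$; $\|\cdot\|$ is the $L^2(\mathbb{R})$ norm; $\Psi_z$ is regarded as an element of $L^2(\mathbb{R})$ (defined almost everywhere). For real $a\ne b$, $|(a,b)|$ denotes the open interval with endpoints $a$ and $b$. The asymptotic statement means: there are constants $M,C>0$ depending only on $V_+,V_-$ such that for all $z$ with $\mathrm{Re}\,z\ge M$ and $\mathrm{Im}\,z\in|(\mathrm{Im}\,V_+,\mathrm{Im}\,V_-)|$, the left side divided by the explicit leading factor on the right differs from $1$ by at most $C/|\mathrm{Re}\,z|$ in absolute value. *)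

theory Defs
  imports "HOL-Analysis.Analysis"
begin

text \<open>
  Elements of the complex Hilbert space \<open>L\<^sup>2(\<real>)\<close> are represented by Borel functions (every class of
  Lebesgue measurable functions has a Borel representative); equality in \<open>L\<^sup>2(\<real>)\<close> is equality
  almost everywhere with respect to Lebesgue measure.
\<close>

definition L2 :: "(real \<Rightarrow> complex) set" where
  "L2 = {f. f \<in> borel_measurable lborel \<and> integrable lborel (\<lambda>x. (cmod (f x))\<^sup>2)}"

definition L2_norm :: "(real \<Rightarrow> complex) \<Rightarrow> real" where
  "L2_norm f = sqrt (LINT x|lborel. (cmod (f x))\<^sup>2)"

definition test_function :: "(real \<Rightarrow> real) \<Rightarrow> bool" where
  "test_function \<phi> \<longleftrightarrow>
     (\<forall>n. (deriv ^^ n) \<phi> differentiable_on UNIV) \<and> compact (closure {x. \<phi> x \<noteq> 0})"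

text \<open>
  Real-valued test functions suffice for complex-valued \<open>u\<close> and \<open>v\<close>, by linearity.
\<close>

definition is_weak_deriv :: "nat \<Rightarrow> (real \<Rightarrow> complex) \<Rightarrow> (real \<Rightarrow> complex) \<Rightarrow> bool" where
  "is_weak_deriv n u v \<longleftrightarrow>
     (\<forall>\<phi>. test_function \<phi> \<longrightarrow>
        (LINT x|lborel. (deriv ^^ n) \<phi> x *\<^sub>R u x) = (-1) ^ n * (LINT x|lborel. \<phi> x *\<^sub>R v x))"

definition sobolev_H :: "nat \<Rightarrow> (real \<Rightarrow> complex) set" where
  "sobolev_H k = {u \<in> L2. \<forall>n\<le>k. \<exists>v\<in>L2. is_weak_deriv n u v}"

text \<open>
  A representative of the weak derivative; it is determined up to equality almost everywhere, and
  meaningful only if an \<open>L\<^sup>2\<close> weak derivative exists.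
\<close>

definition weak_deriv :: "nat \<Rightarrow> (real \<Rightarrow> complex) \<Rightarrow> real \<Rightarrow> complex" where
  "weak_deriv n u = (SOME v. v \<in> L2 \<and> is_weak_deriv n u v)"

text \<open>
  The resolvent set of an operator \<open>T\<close> on \<open>L\<^sup>2(\<real>)\<close> with domain \<open>D\<close>: \<open>T - z\<close> is a bijection from \<open>D\<close>
  onto \<open>L\<^sup>2(\<real>)\<close> (modulo equality almost everywhere) whose inverse is bounded.
\<close>

definition resolvent_set ::
  "(real \<Rightarrow> complex) set \<Rightarrow> ((real \<Rightarrow> complex) \<Rightarrow> real \<Rightarrow> complex) \<Rightarrow> complex set" where
  "resolvent_set D T =
     {z. (\<forall>u\<in>D. \<forall>v\<in>D. (AE x in lborel. T u x - z * u x = T v x - z * v x)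
            \<longrightarrow> (AE x in lborel. u x = v x)) \<and>
         (\<forall>f\<in>L2. \<exists>u\<in>D. AE x in lborel. T u x - z * u x = f x) \<and>
         (\<exists>C. \<forall>u\<in>D. L2_norm u \<le> C * L2_norm (\<lambda>x. T u x - z * u x))}"

definition step_potential :: "complex \<Rightarrow> complex \<Rightarrow> real \<Rightarrow> complex" where
  "step_potential Vp Vm x = (if x \<ge> 0 then Vp else Vm)"

definition schroedinger :: "complex \<Rightarrow> complex \<Rightarrow> (real \<Rightarrow> complex) \<Rightarrow> real \<Rightarrow> complex" where
  "schroedinger Vp Vm u = (\<lambda>x. - weak_deriv 2 u x + step_potential Vp Vm x * u x)"

abbreviation dom_schroedinger :: "(real \<Rightarrow> complex) set" where
  "dom_schroedinger \<equiv> sobolev_H 2"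

definition kp :: "complex \<Rightarrow> complex \<Rightarrow> complex \<Rightarrow> complex" where
  "kp Vp Vm z = csqrt (Vp - z)"

definition km :: "complex \<Rightarrow> complex \<Rightarrow> complex \<Rightarrow> complex" where
  "km Vp Vm z = csqrt (Vm - z)"

definition n1 :: "complex \<Rightarrow> complex \<Rightarrow> complex \<Rightarrow> complex" where
  "n1 Vp Vm z =
     (kp Vp Vm z + cnj (km Vp Vm z)) / (kp Vp Vm z + km Vp Vm z) * of_real \<bar>Im Vp - Im z\<bar>
   + (kp Vp Vm z - cnj (kp Vp Vm z)) / (kp Vp Vm z + km Vp Vm z) * of_real \<bar>Im Vm - Im z\<bar>"

definition p1 :: "complex \<Rightarrow> complex \<Rightarrow> complex \<Rightarrow> complex" where
  "p1 Vp Vm z =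
   - ((km Vp Vm z - cnj (km Vp Vm z)) / (kp Vp Vm z + km Vp Vm z)) * of_real \<bar>Im Vp - Im z\<bar>
   - (cnj (kp Vp Vm z) + km Vp Vm z) / (kp Vp Vm z + km Vp Vm z) * of_real \<bar>Im Vm - Im z\<bar>"

definition n2 :: "complex \<Rightarrow> complex \<Rightarrow> complex \<Rightarrow> complex" where
  "n2 Vp Vm z = - of_real \<bar>Im Vp - Im z\<bar>"

definition p2 :: "complex \<Rightarrow> complex \<Rightarrow> complex \<Rightarrow> complex" where
  "p2 Vp Vm z = of_real \<bar>Im Vm - Im z\<bar>"

definition Psi :: "complex \<Rightarrow> complex \<Rightarrow> complex \<Rightarrow> real \<Rightarrow> complex" where
  "Psi Vp Vm z = (\<lambda>x.
     (n1 Vp Vm z * exp (km Vp Vm z * of_real x)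
        + n2 Vp Vm z * exp (cnj (km Vp Vm z) * of_real x)) * indicator {..<0} x
   + (p1 Vp Vm z * exp (- kp Vp Vm z * of_real x)
        + p2 Vp Vm z * exp (- cnj (kp Vp Vm z) * of_real x)) * indicator {0<..} x)"

end

theory Submission
  imports Defs
begin

text \<open>
  Write \<open>A = |Im V\<^sub>+ - Im z|\<close>, \<open>B = |Im V\<^sub>- - Im z|\<close>, \<open>x = Re z\<close>, and \<open>D = |Im V\<^sub>+ - Im V\<^sub>-|\<close>, which equals
  \<open>A + B\<close> for \<open>z\<close> in the strip.  The four coefficients of \<open>\<Psi>\<^sub>z\<close> are chosen so that \<open>\<Psi>\<^sub>z\<close> and its derivative
  are continuous at the origin (\<open>Psi_matching\<close>).  Hence the second weak derivative is the piecewise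
  classical one, and \<open>\<Psi>\<^sub>z\<close> belongs to \<open>H\<^sup>2\<close> as soon as all four exponentials decay
  (\<open>glue_weak_deriv\<close>).  Decay means \<open>Re k\<^sub>\<plusminus> > 0\<close>; this holds on the resolvent set, since otherwise a
  slightly damped oscillation on one half-line contradicts the boundedness of the inverse
  (\<open>resolvent_set_imp_Re_kp_pos\<close>, \<open>resolvent_set_imp_Re_km_pos\<close>).  To compute with the operator, which
  is defined through an arbitrary choice of the weak derivative, one needs that weak derivatives are
  unique (\<open>weak_deriv_AE_eq\<close>), which rests on the fundamental lemma of the calculus of variations.

  For the asymptotics, put \<open>T = 1/(2 Re k\<^sub>-) + 1/(2 Re k\<^sub>+)\<close>, the squared norm of the function that is
  \<open>e\<^sup>k\<^sup>x\<close> with \<open>k = Re k\<^sub>-\<close> on the left and \<open>e\<^sup>-\<^sup>k\<^sup>x\<close> with \<open>k = Re k\<^sub>+\<close> on the right.  Two facts combine.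
  The residual \<open>(\<L> - z) \<Psi>\<^sub>z\<close> has norm exactly \<open>2 A B \<surd>T\<close> (\<open>L2_norm_schroedinger_Psi_eq\<close>).
  The norm of \<open>\<Psi>\<^sub>z\<close> is \<open>(m + O(1)) \<surd>T\<close> with \<open>m = 4 D x / |V\<^sub>+ - V\<^sub>-|\<close>
  (\<open>L2_norm_Psi_bounds\<close>): the coefficients \<open>n1\<close> and \<open>p1\<close> have modulus \<open>m + O(1)\<close>
  (\<open>Psi_leading_coefficients\<close>), while \<open>n2\<close> and \<open>p2\<close> are bounded by \<open>D\<close>.  The factor \<open>\<surd>T\<close>, which blows up
  when \<open>Im z\<close> approaches the boundary of the strip, cancels in the quotient.  This is why the estimate
  is uniform in \<open>Im z\<close>.  The quotient is \<open>2 A B / (m + O(1))\<close>, and \<open>2 A B / m\<close> is the stated leading term.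
\<close>

section \<open>Smooth bump functions\<close>

text \<open>
  The derivative of \<open>p(1/x) e\<^sup>-\<^sup>1\<^sup>/\<^sup>x\<close> is again of this form, so a family indexed by polynomials
  carries all derivatives of \<open>e\<^sup>-\<^sup>1\<^sup>/\<^sup>x\<close> at once.
\<close>

definition flat :: "real poly \<Rightarrow> real \<Rightarrow> real" where
  "flat p x = (if x > 0 then poly p (1 / x) * exp (- 1 / x) else 0)"

text \<open>
  With \<open>y = 1/x\<close> this is the statement that the exponential beats every power.
\<close>

lemma poly_inverse_exp_tendsto_0:
  fixes p :: "real poly"
  shows "((\<lambda>x. poly p (1 / x) * exp (- 1 / x)) \<longlongrightarrow> 0) (at_right 0)"
proof -
  have "((\<lambda>y. \<Sum>i\<le>degree p. coeff p i * (y ^ i / exp y)) \<longlongrightarrow> (\<Sum>i\<le>degree p. coeff p i * 0)) at_top"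
    by (intro tendsto_intros tendsto_power_div_exp_0)
  then have "((\<lambda>y. poly p y * exp (- y)) \<longlongrightarrow> 0) at_top"
    by (simp add: poly_altdef sum_distrib_right sum_divide_distrib exp_minus field_simps)
  then have "((\<lambda>x. poly p (inverse x) * exp (- inverse x)) \<longlongrightarrow> 0) (at_right 0)"
    by (rule filterlim_compose[OF _ filterlim_inverse_at_top_right])
  then show ?thesis
    by (simp add: inverse_eq_divide)
qed

text \<open>
  In the variable \<open>y = 1/x\<close>, which satisfies \<open>dy/dx = - y\<^sup>2\<close>, differentiating \<open>p(y) e\<^sup>-\<^sup>y\<close> turns \<open>p\<close>
  into \<open>y\<^sup>2 (p - p')\<close>.  At the origin the difference quotient is itself of the form treated in the
  preceding lemma.
\<close>

lemma flat_has_derivative: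
  "(flat p has_real_derivative flat ([:0, 0, 1:] * (p - pderiv p)) x) (at x)"
proof -
  consider "x < 0" | "x = 0" | "x > 0" by linarith
  then show ?thesis
  proof cases
    case 1
    have "((\<lambda>_. 0) has_real_derivative 0) (at x)" by simp
    then have "(flat p has_real_derivative 0) (at x)"
      by (rule has_field_derivative_transform_within_open[where S="{..<0}"])
        (use 1 in \<open>auto simp: flat_def\<close>)
    then show ?thesis using 1 by (simp add: flat_def)
  next
    case 2
    have "((\<lambda>h. flat p h / h) \<longlongrightarrow> 0) (at_right 0)"
      using poly_inverse_exp_tendsto_0[of "[:0, 1:] * p"]
      by (rule Lim_transform_eventually)
        (auto simp: flat_def eventually_at_filter field_simps)
    moreover have "((\<lambda>h. flat p h / h) \<longlongrightarrow> 0) (at_left 0)"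
      by (rule Lim_transform_eventually[of "\<lambda>_. 0"])
        (auto simp: flat_def eventually_at_filter)
    ultimately have "((\<lambda>h. flat p h / h) \<longlongrightarrow> 0) (at 0)"
      by (simp add: filterlim_at_split)
    then show ?thesis
      using 2 by (simp add: DERIV_def flat_def)
  next
    case 3
    have "((\<lambda>x. poly p (1 / x) * exp (- 1 / x)) has_real_derivative
        poly ([:0, 0, 1:] * (p - pderiv p)) (1 / x) * exp (- 1 / x)) (at x)"
      using 3
      by (auto intro!: derivative_eq_intros poly_DERIV[THEN DERIV_chain2]
        simp: field_simps power2_eq_square)
    then have "(flat p has_real_derivative
        poly ([:0, 0, 1:] * (p - pderiv p)) (1 / x) * exp (- 1 / x)) (at x)"
      by (rule has_field_derivative_transform_within_open[where S="{0<..}"])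
        (use 3 in \<open>auto simp: flat_def\<close>)
    then show ?thesis using 3 by (simp add: flat_def)
  qed
qed

text \<open>
  On \<open>(a, b)\<close> both arguments grow linearly in \<open>n\<close> and \<open>e\<^sup>-\<^sup>1\<^sup>/\<^sup>y\<close> tends to \<open>1\<close> as \<open>y\<close> tends to infinity, so
  stretching replaces any normalisation: the bumps increase to the indicator of \<open>(a, b)\<close>.
\<close>

definition bump :: "nat \<Rightarrow> real \<Rightarrow> real \<Rightarrow> real \<Rightarrow> real" where
  "bump n a b x = flat 1 (real n * (x - a)) * flat 1 (real n * (b - x))"

text \<open>
  A space of functions that contains the bumps and is closed under differentiation; membership of
  the iterated derivatives then follows by a plain induction, without an iterated Leibniz rule.
\<close>

inductive_set flat_products :: "real \<Rightarrow> real \<Rightarrow> real \<Rightarrow> (real \<Rightarrow> real) set" for c a b where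
  prod: "(\<lambda>x. s * (flat p (c * (x - a)) * flat q (c * (b - x)))) \<in> flat_products c a b"
| add: "f \<in> flat_products c a b \<Longrightarrow> g \<in> flat_products c a b \<Longrightarrow>
    (\<lambda>x. f x + g x) \<in> flat_products c a b"

lemma flat_products_has_derivative:
  assumes "f \<in> flat_products c a b"
  shows "\<exists>f'\<in>flat_products c a b. \<forall>x. (f has_real_derivative f' x) (at x)"
  using assms
proof induction
  case (prod s p q)
  define D where "D p = [:0, 0, 1:] * (p - pderiv p)" for p :: "real poly"
  have "((\<lambda>x. s * (flat p (c * (x - a)) * flat q (c * (b - x)))) has_real_derivative
      (s * c) * (flat (D p) (c * (x - a)) * flat q (c * (b - x))) +
      (- (s * c)) * (flat p (c * (x - a)) * flat (D q) (c * (b - x)))) (at x)" for x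
    unfolding D_def
    by (rule derivative_eq_intros flat_has_derivative[THEN DERIV_chain2] refl)+
      (simp add: algebra_simps)
  then show ?case
    by (intro bexI[OF _ flat_products.add[OF flat_products.prod flat_products.prod]]) blast
next
  case (add f g)
  then obtain f' g' where "f' \<in> flat_products c a b" "g' \<in> flat_products c a b"
    "\<And>x. (f has_real_derivative f' x) (at x)" "\<And>x. (g has_real_derivative g' x) (at x)"
    by auto
  then show ?case
    by (intro bexI[of _ "\<lambda>x. f' x + g' x"]) (auto intro: DERIV_add flat_products.add)
qed

lemma flat_products_iterated_deriv:
  assumes "f \<in> flat_products c a b"
  shows "(deriv ^^ n) f \<in> flat_products c a b"
proof (induction n)
  case (Suc n)
  then obtain f' where "f' \<in> flat_products c a b"
    "\<And>x. ((deriv ^^ n) f has_real_derivative f' x) (at x)"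
    using flat_products_has_derivative by blast
  moreover from this have "deriv ((deriv ^^ n) f) = f'"
    by (intro ext DERIV_imp_deriv)
  ultimately show ?case by simp
qed (use assms in simp)

lemma test_function_bump: "test_function (bump n a b)"
proof -
  have "bump n a b \<in> flat_products n a b"
    using flat_products.prod[of 1 1 "real n" a 1 b] by (simp add: bump_def[abs_def])
  then have "(deriv ^^ k) (bump n a b) \<in> flat_products n a b" for k
    by (rule flat_products_iterated_deriv)
  then have "(deriv ^^ k) (bump n a b) differentiable_on UNIV" for k
    using flat_products_has_derivative
    by (metis differentiable_on_def differentiable_at_withinI real_differentiable_def)
  moreover have "{x. bump n a b x \<noteq> 0} \<subseteq> {a..b}"
    by (auto simp: bump_def flat_def split: if_splits simp: zero_less_mult_iff)
  then have "compact (closure {x. bump n a b x \<noteq> 0})"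
    by (meson bounded_closed_interval bounded_subset compact_closure)
  ultimately show ?thesis
    by (auto simp: test_function_def)
qed

lemma abs_bump_le: "\<bar>bump n a b x\<bar> \<le> indicator {a<..<b} x"
proof -
  have "\<bar>flat 1 y\<bar> \<le> 1" for y :: real
    by (auto simp: flat_def)
  then have "\<bar>bump n a b x\<bar> \<le> 1"
    by (simp add: bump_def abs_mult mult_le_one)
  moreover have "bump n a b x = 0" if "x \<notin> {a<..<b}"
    using that by (auto simp: bump_def flat_def zero_less_mult_iff)
  ultimately show ?thesis
    by (auto simp: indicator_def)
qed

lemma bump_tendsto: "(\<lambda>n. bump n a b x) \<longlonglongrightarrow> indicator {a<..<b} x"
proof (cases "x \<in> {a<..<b}")
  case True
  have *: "(\<lambda>n. flat 1 (real n * y)) \<longlonglongrightarrow> 1" if "y > 0" for y :: real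
  proof -
    have "(\<lambda>n. exp (- (1 / (real n * y)))) \<longlonglongrightarrow> exp (- 0)"
      using that
      by (intro tendsto_intros tendsto_divide_0[OF tendsto_const]
        filterlim_at_top_imp_at_infinity filterlim_at_top_mult_tendsto_pos[OF tendsto_const])
        (auto simp: filterlim_real_sequentially mult.commute)
    then have "(\<lambda>n. exp (- (1 / (real n * y)))) \<longlonglongrightarrow> 1" by simp
    then show ?thesis
      by (rule Lim_transform_eventually)
        (use that in \<open>auto simp: flat_def eventually_sequentially intro!: exI[of _ 1]\<close>)
  qed
  have "(\<lambda>n. bump n a b x) \<longlonglongrightarrow> 1 * 1"
    unfolding bump_def using True by (intro tendsto_mult *) auto
  then show ?thesis using True by simp
next
  case False
  then have "bump n a b x = 0" for n
    using abs_bump_le[of n a b x] by simp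
  then show ?thesis using False by simp
qed

section \<open>Uniqueness of weak derivatives\<close>

lemma integrable_scaleR_L2:
  fixes \<phi> :: "real \<Rightarrow> real"
  assumes u: "u \<in> L2" and \<phi>: "\<phi> \<in> borel_measurable borel" "integrable lborel (\<lambda>x. (\<phi> x)\<^sup>2)"
  shows "integrable lborel (\<lambda>x. \<phi> x *\<^sub>R u x)"
proof (rule Bochner_Integration.integrable_bound)
  show "integrable lborel (\<lambda>x. (\<phi> x)\<^sup>2 + (cmod (u x))\<^sup>2)"
    using u \<phi> by (auto simp: L2_def)
  show "(\<lambda>x. \<phi> x *\<^sub>R u x) \<in> borel_measurable lborel"
    using u \<phi>(1) by (auto simp: L2_def)
  have "\<bar>\<phi> x\<bar> * cmod (u x) \<le> (\<phi> x)\<^sup>2 + (cmod (u x))\<^sup>2" for x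
    using sum_squares_bound[of "\<bar>\<phi> x\<bar>" "cmod (u x)"] by (simp add: mult.assoc) (smt (verit) abs_ge_zero mult_nonneg_nonneg norm_ge_zero)
  then show "AE x in lborel. norm (\<phi> x *\<^sub>R u x) \<le> norm ((\<phi> x)\<^sup>2 + (cmod (u x))\<^sup>2)"
    by simp
qed

lemma test_function_differentiable:
  assumes "test_function \<phi>"
  shows "(\<phi> has_real_derivative deriv \<phi> x) (at x)"
proof -
  have "(deriv ^^ 0) \<phi> differentiable_on UNIV"
    using assms unfolding test_function_def by blast
  then show ?thesis
    by (auto simp: differentiable_on_def real_differentiable_def DERIV_deriv_iff_real_differentiable)
qed

lemma continuous_on_test_function:
  assumes "test_function \<phi>" shows "continuous_on A \<phi>"
  using test_function_differentiable[OF assms]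
  by (meson DERIV_continuous_on DERIV_subset subset_UNIV)

lemma test_function_support:
  assumes "test_function \<phi>"
  obtains R where "R > 0" "\<And>x. \<bar>x\<bar> \<ge> R \<Longrightarrow> \<phi> x = 0"
proof -
  have "bounded {x. \<phi> x \<noteq> 0}"
    using assms bounded_subset[OF compact_imp_bounded closure_subset]
    by (auto simp: test_function_def)
  then obtain R where R: "R > 0" "\<forall>x\<in>{x. \<phi> x \<noteq> 0}. norm x \<le> R"
    unfolding bounded_pos by blast
  show ?thesis
    using R by (intro that[of "R + 1"]) force+
qed

lemma test_function_deriv:
  assumes "test_function \<phi>" shows "test_function (deriv \<phi>)"
proof -
  have "(deriv ^^ n) (deriv \<phi>) differentiable_on UNIV" for n
    using assms unfolding test_function_def by (metis funpow_Suc_right comp_apply)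
  moreover obtain R where R: "R > 0" "\<And>x. \<bar>x\<bar> \<ge> R \<Longrightarrow> \<phi> x = 0"
    using test_function_support[OF assms] by blast
  have "deriv \<phi> x = 0" if "x \<notin> {-R..R}" for x
  proof (rule DERIV_imp_deriv)
    have "((\<lambda>_. 0) has_real_derivative 0) (at x)" by simp
    then show "(\<phi> has_real_derivative 0) (at x)"
      by (rule has_field_derivative_transform_within_open[where S="- {-R..R}"])
        (use R(2) that in auto)
  qed
  then have "{x. deriv \<phi> x \<noteq> 0} \<subseteq> {-R..R}" by blast
  then have "compact (closure {x. deriv \<phi> x \<noteq> 0})"
    by (meson bounded_closed_interval bounded_subset compact_closure)
  ultimately show ?thesis
    by (simp add: test_function_def)
qed

lemma integrable_test_function_scaleR:
  assumes \<phi>: "test_function \<phi>" and u: "u \<in> L2"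
  shows "integrable lborel (\<lambda>x. \<phi> x *\<^sub>R u x)"
proof (rule integrable_scaleR_L2[OF u])
  show "\<phi> \<in> borel_measurable borel"
    using continuous_on_test_function[OF \<phi>] by (rule borel_measurable_continuous_onI)
  obtain R where R: "R > 0" "\<And>x. \<bar>x\<bar> \<ge> R \<Longrightarrow> \<phi> x = 0"
    using test_function_support[OF \<phi>] by blast
  have "integrable lborel (\<lambda>x. indicator {-R..R} x *\<^sub>R (\<phi> x)\<^sup>2)"
    by (intro borel_integrable_compact continuous_intros continuous_on_test_function[OF \<phi>]) auto
  moreover have "(\<lambda>x. indicator {-R..R} x *\<^sub>R (\<phi> x)\<^sup>2) = (\<lambda>x. (\<phi> x)\<^sup>2)"
  proof
    show "indicator {-R..R} x *\<^sub>R (\<phi> x)\<^sup>2 = (\<phi> x)\<^sup>2" for x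
      using R(2)[of x] by (cases "\<bar>x\<bar> \<ge> R") (auto simp: indicator_def abs_if split: if_splits)
  qed
  ultimately show "integrable lborel (\<lambda>x. (\<phi> x)\<^sup>2)" by simp
qed

text \<open>
  The sets over which the integral of \<open>f\<close> vanishes form a Dynkin system, and the open intervals are an
  intersection-stable generator of the Borel sets.  Hence the integral vanishes over every Borel set.
\<close>

lemma integrable_zero_on_intervals_imp_AE_zero:
  fixes f :: "real \<Rightarrow> 'a :: {second_countable_topology, banach}"
  assumes f: "integrable lborel f"
    and whole: "(LINT x|lborel. f x) = 0"
    and intervals: "\<And>a b. (LINT x:{a<..<b}|lborel. f x) = 0"
  shows "AE x in lborel. f x = 0"
proof (rule sigma_finite_measure.density_zero[OF lborel.sigma_finite_measure_axioms f])
  let ?G = "range (\<lambda>(a, b). {a<..<b :: real})"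
  have sets: "sigma_sets UNIV ?G = sets lborel"
    unfolding sets_lborel borel_eq_box[where 'a=real] box_real by (simp add: sets_measure_of)
  have set_int: "set_integrable lborel A f" if "A \<in> sets lborel" for A
    using f that integrable_mult_indicator[of A lborel f] unfolding set_integrable_def by blast
  fix A :: "real set"
  assume "A \<in> sets lborel"
  then have "A \<in> sigma_sets UNIV ?G" by (simp add: sets)
  have "Int_stable ?G"
    by (auto simp: Int_stable_def image_iff Int_greaterThanLessThan)
  moreover have "?G \<subseteq> Pow UNIV" by simp
  moreover note \<open>A \<in> sigma_sets UNIV ?G\<close>
  ultimately show "(LINT x:A|lborel. f x) = 0"
  proof (induction rule: sigma_sets_induct_disjoint)
    case (basic A)
    then show ?case using intervals by auto
  next
    case (compl A)
    then have A: "A \<in> sets lborel" by (simp add: sets)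
    have "(LINT x:A \<union> (UNIV - A)|lborel. f x) =
        (LINT x:A|lborel. f x) + (LINT x:UNIV - A|lborel. f x)"
      by (rule set_integral_Un) (use A set_int in auto)
    with compl whole show ?case
      by (simp add: set_lebesgue_integral_def)
  next
    case (union A)
    then have A: "A i \<in> sets lborel" for i by (auto simp: sets)
    have "(LINT x:(\<Union>i. A i)|lborel. f x) = (\<Sum>i. (LINT x:(A i)|lborel. f x))"
      using union(1) A
      by (intro lebesgue_integral_countable_add set_int) (auto simp: disjoint_family_on_def)
    then show ?case using union by simp
  qed (auto simp: set_lebesgue_integral_def)
qed

text \<open>
  By dominated convergence along the bumps, the integral of \<open>w\<close> over every bounded open interval is
  zero.  As \<open>w\<close> need not be integrable on the whole line, it is first cut off to \<open>(-N, N)\<close>.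
\<close>

lemma fundamental_lemma_calculus_of_variations:
  assumes w: "w \<in> L2"
    and zero: "\<And>\<phi>. test_function \<phi> \<Longrightarrow> (LINT x|lborel. \<phi> x *\<^sub>R w x) = 0"
  shows "AE x in lborel. w x = 0"
proof -
  have int: "integrable lborel (\<lambda>x. indicator {a<..<b} x *\<^sub>R w x)" for a b :: real
  proof (rule integrable_scaleR_L2[OF w])
    have "(\<lambda>x. (indicator {a<..<b} x)\<^sup>2) = (indicator {a<..<b} :: real \<Rightarrow> real)"
      by (auto simp: indicator_def)
    moreover have "integrable lborel (indicator {a<..<b} :: real \<Rightarrow> real)"
      by (cases "a \<le> b") auto
    ultimately show "integrable lborel (\<lambda>x. (indicator {a<..<b} x :: real)\<^sup>2)"
      by simp
  qed simp
  have interval: "(LINT x|lborel. indicator {a<..<b} x *\<^sub>R w x) = 0" for a b :: real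
  proof -
    have "(\<lambda>n. LINT x|lborel. bump n a b x *\<^sub>R w x) \<longlonglongrightarrow>
        (LINT x|lborel. indicator {a<..<b} x *\<^sub>R w x)"
    proof (rule integral_dominated_convergence[where w="\<lambda>x. norm (indicator {a<..<b} x *\<^sub>R w x)"])
      show "(\<lambda>x. bump n a b x *\<^sub>R w x) \<in> borel_measurable lborel" for n
        by (rule borel_measurable_integrable[OF integrable_test_function_scaleR[OF test_function_bump w]])
      show "AE x in lborel. (\<lambda>n. bump n a b x *\<^sub>R w x) \<longlonglongrightarrow> indicator {a<..<b} x *\<^sub>R w x"
        by (intro AE_I2 tendsto_intros bump_tendsto)
      show "AE x in lborel. norm (bump n a b x *\<^sub>R w x) \<le> norm (indicator {a<..<b} x *\<^sub>R w x)" for n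
        using abs_bump_le by (auto intro!: AE_I2 mult_right_mono)
    qed (use int integrable_norm borel_measurable_integrable in blast)+
    then show ?thesis
      by (simp add: zero test_function_bump LIMSEQ_const_iff)
  qed
  have "AE x in lborel. indicator {- real N<..<real N} x *\<^sub>R w x = 0" for N
  proof (rule integrable_zero_on_intervals_imp_AE_zero[OF int interval])
    fix a b :: real
    have "(LINT x:{a<..<b}|lborel. indicator {- real N<..<real N} x *\<^sub>R w x) =
        (LINT x|lborel. indicator {max a (- real N)<..<min b (real N)} x *\<^sub>R w x)"
      unfolding set_lebesgue_integral_def
      by (intro Bochner_Integration.integral_cong) (auto simp: indicator_def)
    then show "(LINT x:{a<..<b}|lborel. indicator {- real N<..<real N} x *\<^sub>R w x) = 0"
      by (simp add: interval)
  qed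
  then have "AE x in lborel. \<forall>N. indicator {- real N<..<real N} x *\<^sub>R w x = 0"
    unfolding AE_all_countable ..
  then show ?thesis
  proof eventually_elim
    case (elim x)
    obtain N where "\<bar>x\<bar> < real N" using reals_Archimedean2 by blast
    then have "x \<in> {- real N<..<real N}" by auto
    with elim show ?case by (metis indicator_simps(1) scaleR_one)
  qed
qed

lemma L2_diff: "u \<in> L2 \<Longrightarrow> v \<in> L2 \<Longrightarrow> (\<lambda>x. u x - v x) \<in> L2"
proof -
  assume u: "u \<in> L2" and v: "v \<in> L2"
  have "integrable lborel (\<lambda>x. (cmod (u x - v x))\<^sup>2)"
  proof (rule Bochner_Integration.integrable_bound)
    show "integrable lborel (\<lambda>x. 2 * (cmod (u x))\<^sup>2 + 2 * (cmod (v x))\<^sup>2)"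
      using u v by (auto simp: L2_def)
    have "(cmod (u x - v x))\<^sup>2 \<le> 2 * (cmod (u x))\<^sup>2 + 2 * (cmod (v x))\<^sup>2" for x
    proof -
      have "(cmod (u x - v x))\<^sup>2 \<le> (cmod (u x) + cmod (v x))\<^sup>2"
        by (intro power_mono norm_triangle_ineq4) simp
      also have "\<dots> \<le> 2 * (cmod (u x))\<^sup>2 + 2 * (cmod (v x))\<^sup>2"
        using sum_squares_bound[of "cmod (u x)" "cmod (v x)"] by (simp add: power2_sum)
      finally show ?thesis .
    qed
    then show "AE x in lborel. norm ((cmod (u x - v x))\<^sup>2) \<le> norm (2 * (cmod (u x))\<^sup>2 + 2 * (cmod (v x))\<^sup>2)"
      by simp
  qed (use u v in \<open>auto simp: L2_def\<close>)
  then show ?thesis using u v by (auto simp: L2_def)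
qed

text \<open>
  This makes the chosen representative of the weak derivative computable: any \<open>L\<^sup>2\<close> candidate that
  passes the test with \<open>\<phi>\<close> is the right one.
\<close>

lemma weak_deriv_AE_eq:
  assumes v: "v \<in> L2" "is_weak_deriv n u v"
  shows "AE x in lborel. weak_deriv n u x = v x"
proof -
  have w: "weak_deriv n u \<in> L2 \<and> is_weak_deriv n u (weak_deriv n u)"
    unfolding weak_deriv_def by (rule someI[of _ v]) (use v in blast)
  have "AE x in lborel. weak_deriv n u x - v x = 0"
  proof (rule fundamental_lemma_calculus_of_variations)
    fix \<phi> assume \<phi>: "test_function \<phi>"
    have "(-1) ^ n * (LINT x|lborel. \<phi> x *\<^sub>R weak_deriv n u x) = (-1) ^ n * (LINT x|lborel. \<phi> x *\<^sub>R v x)"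
      using w v(2) \<phi> unfolding is_weak_deriv_def by metis
    then have "(LINT x|lborel. \<phi> x *\<^sub>R weak_deriv n u x) = (LINT x|lborel. \<phi> x *\<^sub>R v x)"
      by simp
    then show "(LINT x|lborel. \<phi> x *\<^sub>R (weak_deriv n u x - v x)) = 0"
      using w v(1) \<phi> by (simp add: scaleR_diff_right integrable_test_function_scaleR)
  qed (use w v(1) L2_diff in blast)
  then show ?thesis by simp
qed

section \<open>Functions glued at the origin\<close>

definition glue :: "(real \<Rightarrow> complex) \<Rightarrow> (real \<Rightarrow> complex) \<Rightarrow> real \<Rightarrow> complex" where
  "glue f g x = f x * indicator {..<0} x + g x * indicator {0<..} x"

lemma glue_simps [simp]:
  "x < 0 \<Longrightarrow> glue f g x = f x" "x > 0 \<Longrightarrow> glue f g x = g x" "glue f g 0 = 0"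
  by (auto simp: glue_def)

lemma AE_nonzero: "AE x in lborel. x \<noteq> (0::real)"
  by (rule AE_lborel_singleton)

text \<open>
  Integrating \<open>(\<phi> f)'\<close> over \<open>[-R, 0]\<close> and \<open>(\<phi> g)'\<close> over \<open>[0, R]\<close>, with \<open>\<phi>\<close> supported inside \<open>(-R, R)\<close>,
  leaves only the boundary terms \<open>\<phi>(0) f(0)\<close> and \<open>- \<phi>(0) g(0)\<close>, which cancel when the two pieces match.
\<close>

lemma glue_integration_by_parts:
  assumes \<phi>: "test_function \<phi>"
    and f: "\<And>x. (f has_vector_derivative f' x) (at x)" "continuous_on UNIV f'"
    and g: "\<And>x. (g has_vector_derivative g' x) (at x)" "continuous_on UNIV g'"
    and match: "f 0 = g 0"
    and L2: "glue f g \<in> L2" "glue f' g' \<in> L2"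
  shows "(LINT x|lborel. deriv \<phi> x *\<^sub>R glue f g x) = - (LINT x|lborel. \<phi> x *\<^sub>R glue f' g' x)"
proof -
  have int: "integrable lborel (\<lambda>x. \<phi> x *\<^sub>R glue f' g' x)" "integrable lborel (\<lambda>x. deriv \<phi> x *\<^sub>R glue f g x)"
    by (intro integrable_test_function_scaleR test_function_deriv \<phi> L2)+
  obtain R1 where R1: "R1 > 0" "\<And>x. \<bar>x\<bar> \<ge> R1 \<Longrightarrow> \<phi> x = 0"
    using test_function_support[OF \<phi>] by blast
  obtain R2 where R2: "R2 > 0" "\<And>x. \<bar>x\<bar> \<ge> R2 \<Longrightarrow> deriv \<phi> x = 0"
    using test_function_support[OF test_function_deriv[OF \<phi>]] by blast
  define R where "R = max R1 R2"
  have R: "R > 0" "\<And>x. \<bar>x\<bar> \<ge> R \<Longrightarrow> \<phi> x = 0" "\<And>x. \<bar>x\<bar> \<ge> R \<Longrightarrow> deriv \<phi> x = 0"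
    using R1 R2 by (auto simp: R_def)
  have side: "has_bochner_integral lborel
      (\<lambda>x. indicator {a..b} x *\<^sub>R (\<phi> x *\<^sub>R h' x + deriv \<phi> x *\<^sub>R h x)) (\<phi> b *\<^sub>R h b - \<phi> a *\<^sub>R h a)"
    if h: "\<And>x. (h has_vector_derivative h' x) (at x)" "continuous_on UNIV h'" and "a \<le> b"
    for h h' :: "real \<Rightarrow> complex" and a b
  proof (rule has_bochner_integral_FTC_Icc[OF \<open>a \<le> b\<close>])
    show "((\<lambda>x. \<phi> x *\<^sub>R h x) has_vector_derivative \<phi> x *\<^sub>R h' x + deriv \<phi> x *\<^sub>R h x) (at x within {a..b})" for x
      by (rule has_vector_derivative_scaleR[OF DERIV_subset[OF test_function_differentiable[OF \<phi>] subset_UNIV]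
          has_vector_derivative_at_within[OF h(1)]])
    have "continuous_on {a..b} h"
      by (rule continuous_on_vector_derivative[OF has_vector_derivative_at_within[OF h(1)]])
    then show "continuous_on {a..b} (\<lambda>x. \<phi> x *\<^sub>R h' x + deriv \<phi> x *\<^sub>R h x)"
      using continuous_on_test_function[OF \<phi>] continuous_on_test_function[OF test_function_deriv[OF \<phi>]]
        continuous_on_subset[OF h(2) subset_UNIV]
      by (intro continuous_on_add continuous_on_scaleR)
  qed
  have total: "has_bochner_integral lborel
     (\<lambda>x. indicator {-R..0} x *\<^sub>R (\<phi> x *\<^sub>R f' x + deriv \<phi> x *\<^sub>R f x) +
          indicator {0..R} x *\<^sub>R (\<phi> x *\<^sub>R g' x + deriv \<phi> x *\<^sub>R g x))
     ((\<phi> 0 *\<^sub>R f 0 - \<phi> (-R) *\<^sub>R f (-R)) + (\<phi> R *\<^sub>R g R - \<phi> 0 *\<^sub>R g 0))"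
    by (intro has_bochner_integral_add side[OF f] side[OF g]) (use R(1) in simp_all)
  have "0 = (\<phi> 0 *\<^sub>R f 0 - \<phi> (-R) *\<^sub>R f (-R)) + (\<phi> R *\<^sub>R g R - \<phi> 0 *\<^sub>R g 0)"
    using R(1) R(2)[of R] R(2)[of "-R"] match by simp
  also have "\<dots> = (LINT x|lborel. indicator {-R..0} x *\<^sub>R (\<phi> x *\<^sub>R f' x + deriv \<phi> x *\<^sub>R f x) +
          indicator {0..R} x *\<^sub>R (\<phi> x *\<^sub>R g' x + deriv \<phi> x *\<^sub>R g x))"
    using conjunct2[OF total[unfolded has_bochner_integral_iff]] by (rule sym)
  also have "\<dots> =
      (LINT x|lborel. \<phi> x *\<^sub>R glue f' g' x + deriv \<phi> x *\<^sub>R glue f g x)"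
  proof (rule integral_cong_AE)
    show "AE x in lborel. indicator {-R..0} x *\<^sub>R (\<phi> x *\<^sub>R f' x + deriv \<phi> x *\<^sub>R f x) +
          indicator {0..R} x *\<^sub>R (\<phi> x *\<^sub>R g' x + deriv \<phi> x *\<^sub>R g x) =
          \<phi> x *\<^sub>R glue f' g' x + deriv \<phi> x *\<^sub>R glue f g x"
      using AE_nonzero
    proof eventually_elim
      case (elim x)
      consider "x < 0" | "x > 0" using elim by linarith
      then show ?case
        using R(2)[of x] R(3)[of x] by cases (auto simp: indicator_def)
    qed
  qed (rule borel_measurable_integrable[OF conjunct1[OF total[unfolded has_bochner_integral_iff]]]
      borel_measurable_integrable[OF Bochner_Integration.integrable_add[OF int]])+
  also have "\<dots> = (LINT x|lborel. \<phi> x *\<^sub>R glue f' g' x) + (LINT x|lborel. deriv \<phi> x *\<^sub>R glue f g x)"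
    using int by simp
  finally show ?thesis by (metis add.commute eq_neg_iff_add_eq_0)
qed

text \<open>
  The first matching condition removes the delta distribution from the first derivative, the second
  one removes it from the second derivative.
\<close>

lemma glue_weak_deriv:
  assumes f: "\<And>x. (f has_vector_derivative f' x) (at x)" "\<And>x. (f' has_vector_derivative f'' x) (at x)"
      "continuous_on UNIV f''"
    and g: "\<And>x. (g has_vector_derivative g' x) (at x)" "\<And>x. (g' has_vector_derivative g'' x) (at x)"
      "continuous_on UNIV g''"
    and match: "f 0 = g 0" "f' 0 = g' 0"
    and L2: "glue f g \<in> L2" "glue f' g' \<in> L2" "glue f'' g'' \<in> L2"
  shows glue_in_sobolev_H2: "glue f g \<in> sobolev_H 2"
    and weak_deriv_glue: "AE x in lborel. weak_deriv 2 (glue f g) x = glue f'' g'' x"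
proof -
  have cont: "continuous_on UNIV f'" "continuous_on UNIV g'"
    using f(2) g(2) by (auto intro: continuous_on_vector_derivative)
  have first: "is_weak_deriv 1 (glue f g) (glue f' g')"
    unfolding is_weak_deriv_def
    using glue_integration_by_parts[OF _ f(1) cont(1) g(1) cont(2) match(1) L2(1,2)] by simp
  have second: "is_weak_deriv 2 (glue f g) (glue f'' g'')"
    unfolding is_weak_deriv_def
    using glue_integration_by_parts[OF _ f(1) cont(1) g(1) cont(2) match(1) L2(1,2)]
      glue_integration_by_parts[OF _ f(2,3) g(2,3) match(2) L2(2,3)]
    by (simp add: numeral_2_eq_2 test_function_deriv)
  have "is_weak_deriv 0 (glue f g) (glue f g)"
    by (simp add: is_weak_deriv_def)
  then have "\<exists>v\<in>L2. is_weak_deriv n (glue f g) v" if "n \<le> 2" for n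
    using that first second L2 by (auto simp: numeral_2_eq_2 le_Suc_eq)
  then show "glue f g \<in> sobolev_H 2"
    using L2(1) by (simp add: sobolev_H_def)
  show "AE x in lborel. weak_deriv 2 (glue f g) x = glue f'' g'' x"
    by (rule weak_deriv_AE_eq[OF L2(3) second])
qed

lemma has_bochner_integral_two_sided_exp:
  fixes r q :: real
  assumes "r > 0" "q > 0"
  shows "has_bochner_integral lborel
    (\<lambda>x. c * (indicator {..<0} x * exp (r * x)) + d * (indicator {0<..} x * exp (- q * x))) (c / r + d / q)"
proof -
  have right: "has_bochner_integral lborel (\<lambda>x. indicator {0<..} x * exp (- q * x)) (1 / q)" if "q > 0" for q :: real
  proof (rule has_bochner_integral_nn_integral)
    have lim: "((\<lambda>x. - exp (- q * x) / q) \<longlongrightarrow> - 0 / q) at_top"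
      using that
      by (intro tendsto_intros filterlim_compose[OF exp_at_bot]
          filterlim_tendsto_neg_mult_at_bot[OF tendsto_const _ filterlim_ident]) auto
    have "(\<integral>\<^sup>+x. ennreal (indicator {0<..} x * exp (- q * x)) \<partial>lborel) =
        (\<integral>\<^sup>+x. ennreal (exp (- q * x)) * indicator {0..} x \<partial>lborel)"
      using AE_nonzero by (intro nn_integral_cong_AE) (auto simp: indicator_def elim!: eventually_mono)
    also have "\<dots> = ennreal (- 0 / q - (- exp (- q * 0) / q))"
      using that
      by (intro nn_integral_FTC_atLeast lim) (auto intro!: derivative_eq_intros)
    finally show "(\<integral>\<^sup>+x. ennreal (indicator {0<..} x * exp (- q * x)) \<partial>lborel) = ennreal (1 / q)"
      by simp
  qed (use that in auto)
  have "has_bochner_integral lborel (\<lambda>x. indicator {0<..} (0 + (-1) * x) * exp (- r * (0 + (-1) * x))) (1 / r /\<^sub>R \<bar>-1\<bar>)"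
    using lborel_has_bochner_integral_real_affine_iff[THEN iffD1, OF _ right[OF \<open>r > 0\<close>], of "-1" 0] by simp
  moreover have "indicator {0<..} (0 + (-1) * x) = (indicator {..<0} x :: real)" for x :: real
    by (auto simp: indicator_def)
  ultimately have left: "has_bochner_integral lborel (\<lambda>x. indicator {..<0} x * exp (r * x)) (1 / r)"
    by simp
  show ?thesis
    using has_bochner_integral_add[OF has_bochner_integral_mult_right[of c, OF left]
        has_bochner_integral_mult_right[of d, OF right[OF \<open>q > 0\<close>]]]
    by simp
qed

text \<open>
  Pointwise comparison with pure exponentials, from above here and from below in the next lemma,
  is all that is needed to estimate the norms: no cross terms have to be integrated.
\<close>

lemma glue_exp_bounded:
  assumes meas: "f \<in> borel_measurable borel" "g \<in> borel_measurable borel"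
    and "r > 0" "q > 0" "c \<ge> 0" "d \<ge> 0"
    and f: "\<And>x. x < 0 \<Longrightarrow> cmod (f x) \<le> c * exp (r * x)"
    and g: "\<And>x. x > 0 \<Longrightarrow> cmod (g x) \<le> d * exp (- q * x)"
  shows glue_in_L2: "glue f g \<in> L2"
    and L2_norm_glue_le: "(L2_norm (glue f g))\<^sup>2 \<le> c\<^sup>2 / (2 * r) + d\<^sup>2 / (2 * q)"
proof -
  define h where "h x = c\<^sup>2 * (indicator {..<0} x * exp (2 * r * x)) +
    d\<^sup>2 * (indicator {0<..} x * exp (- (2 * q) * x))" for x
  have h: "has_bochner_integral lborel h (c\<^sup>2 / (2 * r) + d\<^sup>2 / (2 * q))"
    unfolding h_def by (rule has_bochner_integral_two_sided_exp) (use assms in auto)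
  have square: "(b * exp y)\<^sup>2 = b\<^sup>2 * exp (2 * y)" for b y :: real
    by (simp add: power_mult_distrib exp_double)
  have le: "(cmod (glue f g x))\<^sup>2 \<le> h x" for x
  proof -
    consider "x < 0" | "x = 0" | "x > 0" by linarith
    then show ?thesis
    proof cases
      case 1
      then have "(cmod (f x))\<^sup>2 \<le> (c * exp (r * x))\<^sup>2"
        using f[of x] by (intro power_mono) auto
      then show ?thesis using 1
        by (simp add: h_def square mult.assoc)
    next
      case 3
      then have "(cmod (g x))\<^sup>2 \<le> (d * exp (- q * x))\<^sup>2"
        using g[of x] by (intro power_mono) auto
      then show ?thesis using 3
        by (simp add: h_def square mult.assoc)
    qed (simp add: h_def)
  qed
  have m: "glue f g \<in> borel_measurable lborel"
    unfolding glue_def[abs_def] using meas by simp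
  have int: "integrable lborel (\<lambda>x. (cmod (glue f g x))\<^sup>2)"
  proof (rule Bochner_Integration.integrable_bound[OF conjunct1[OF h[unfolded has_bochner_integral_iff]]])
    show "AE x in lborel. norm ((cmod (glue f g x))\<^sup>2) \<le> norm (h x)"
    proof (rule AE_I2)
      show "norm ((cmod (glue f g x))\<^sup>2) \<le> norm (h x)" for x
        using le[of x] by simp
    qed
  qed (use m in simp)
  then show "glue f g \<in> L2"
    using m by (simp add: L2_def)
  have "(LINT x|lborel. (cmod (glue f g x))\<^sup>2) \<le> (LINT x|lborel. h x)"
    using int h le by (intro integral_mono) (auto simp: has_bochner_integral_iff)
  then show "(L2_norm (glue f g))\<^sup>2 \<le> c\<^sup>2 / (2 * r) + d\<^sup>2 / (2 * q)"
    using h by (simp add: L2_norm_def has_bochner_integral_iff)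
qed

lemma L2_norm_glue_ge:
  assumes L2: "glue f g \<in> L2"
    and "r > 0" "q > 0" "c \<ge> 0" "d \<ge> 0"
    and f: "\<And>x. x < 0 \<Longrightarrow> c * exp (r * x) \<le> cmod (f x)"
    and g: "\<And>x. x > 0 \<Longrightarrow> d * exp (- q * x) \<le> cmod (g x)"
  shows "c\<^sup>2 / (2 * r) + d\<^sup>2 / (2 * q) \<le> (L2_norm (glue f g))\<^sup>2"
proof -
  define h where "h x = c\<^sup>2 * (indicator {..<0} x * exp (2 * r * x)) +
    d\<^sup>2 * (indicator {0<..} x * exp (- (2 * q) * x))" for x
  have h: "has_bochner_integral lborel h (c\<^sup>2 / (2 * r) + d\<^sup>2 / (2 * q))"
    unfolding h_def by (rule has_bochner_integral_two_sided_exp) (use assms in auto)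
  have square: "(b * exp y)\<^sup>2 = b\<^sup>2 * exp (2 * y)" for b y :: real
    by (simp add: power_mult_distrib exp_double)
  have le: "h x \<le> (cmod (glue f g x))\<^sup>2" for x
  proof -
    consider "x < 0" | "x = 0" | "x > 0" by linarith
    then show ?thesis
    proof cases
      case 1
      then have "(c * exp (r * x))\<^sup>2 \<le> (cmod (f x))\<^sup>2"
        using f[of x] \<open>c \<ge> 0\<close> by (intro power_mono) auto
      then show ?thesis using 1
        by (simp add: h_def square mult.assoc)
    next
      case 3
      then have "(d * exp (- q * x))\<^sup>2 \<le> (cmod (g x))\<^sup>2"
        using g[of x] \<open>d \<ge> 0\<close> by (intro power_mono) auto
      then show ?thesis using 3
        by (simp add: h_def square mult.assoc)
    qed (simp add: h_def)
  qed
  have "(LINT x|lborel. h x) \<le> (LINT x|lborel. (cmod (glue f g x))\<^sup>2)"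
    using L2 h le by (intro integral_mono) (auto simp: has_bochner_integral_iff L2_def)
  then show ?thesis
    using h by (simp add: L2_norm_def has_bochner_integral_iff)
qed

section \<open>The operator on piecewise exponential functions\<close>

lemma weak_deriv_in_L2:
  assumes "v \<in> L2" "is_weak_deriv n u v"
  shows "weak_deriv n u \<in> L2"
  unfolding weak_deriv_def by (rule someI2[of _ v]) (use assms in blast)+

lemma L2_norm_nonneg: "L2_norm f \<ge> 0"
  by (simp add: L2_norm_def)

lemma L2_norm_cong_AE:
  assumes "f \<in> borel_measurable borel" "g \<in> borel_measurable borel"
    and "AE x in lborel. f x = g x"
  shows "L2_norm f = L2_norm g"
proof -
  have "(LINT x|lborel. (cmod (f x))\<^sup>2) = (LINT x|lborel. (cmod (g x))\<^sup>2)"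
    by (rule integral_cong_AE) (use assms in auto)
  then show ?thesis by (simp add: L2_norm_def)
qed

definition exp_sum :: "complex \<Rightarrow> complex \<Rightarrow> complex \<Rightarrow> complex \<Rightarrow> real \<Rightarrow> complex" where
  "exp_sum a \<alpha> b \<beta> x = a * exp (\<alpha> * of_real x) + b * exp (\<beta> * of_real x)"

lemma exp_sum_has_derivative:
  "(exp_sum a \<alpha> b \<beta> has_vector_derivative exp_sum (a * \<alpha>) \<alpha> (b * \<beta>) \<beta> x) (at x)"
  unfolding exp_sum_def
  by (rule has_vector_derivative_eq_rhs,
      (rule derivative_intros has_vector_derivative_real_field)+)
    (simp add: algebra_simps)

lemma continuous_on_exp_sum: "continuous_on A (exp_sum a \<alpha> b \<beta>)"
  unfolding exp_sum_def by (intro continuous_intros)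

lemma borel_measurable_exp_sum: "exp_sum a \<alpha> b \<beta> \<in> borel_measurable borel"
  by (rule borel_measurable_continuous_onI[OF continuous_on_exp_sum])

lemma cmod_exp_sum_le:
  assumes "Re \<alpha> * x \<le> s" "Re \<beta> * x \<le> s"
  shows "cmod (exp_sum a \<alpha> b \<beta> x) \<le> (cmod a + cmod b) * exp s"
proof -
  have "cmod (exp_sum a \<alpha> b \<beta> x) \<le> cmod a * exp (Re \<alpha> * x) + cmod b * exp (Re \<beta> * x)"
    unfolding exp_sum_def
    by (rule order_trans[OF norm_triangle_ineq]) (simp add: norm_mult)
  also have "\<dots> \<le> cmod a * exp s + cmod b * exp s"
    using assms by (intro add_mono mult_left_mono) auto
  finally show ?thesis by (simp add: algebra_simps)
qed

lemma cmod_exp_sum_ge: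
  assumes "Re \<alpha> * x = s" "Re \<beta> * x = s"
  shows "(cmod a - cmod b) * exp s \<le> cmod (exp_sum a \<alpha> b \<beta> x)"
proof -
  have "cmod (a * exp (\<alpha> * of_real x)) - cmod (b * exp (\<beta> * of_real x)) \<le> cmod (exp_sum a \<alpha> b \<beta> x)"
    unfolding exp_sum_def by (rule norm_diff_ineq)
  then show ?thesis using assms by (simp add: norm_mult algebra_simps)
qed

lemma glue_exp_sum_bounded:
  assumes "r > 0" "q > 0" "r \<le> Re \<alpha>" "r \<le> Re \<beta>" "Re \<gamma> \<le> - q" "Re \<delta> \<le> - q"
  shows glue_exp_sum_in_L2: "glue (exp_sum a \<alpha> b \<beta>) (exp_sum c \<gamma> d \<delta>) \<in> L2"
    and L2_norm_glue_exp_sum_le: "(L2_norm (glue (exp_sum a \<alpha> b \<beta>) (exp_sum c \<gamma> d \<delta>)))\<^sup>2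
      \<le> (cmod a + cmod b)\<^sup>2 / (2 * r) + (cmod c + cmod d)\<^sup>2 / (2 * q)"
proof -
  have f: "cmod (exp_sum a \<alpha> b \<beta> x) \<le> (cmod a + cmod b) * exp (r * x)" if "x < 0" for x
    using that assms by (intro cmod_exp_sum_le mult_right_mono_neg) auto
  have g: "cmod (exp_sum c \<gamma> d \<delta> x) \<le> (cmod c + cmod d) * exp (- q * x)" if "x > 0" for x
    using that assms by (intro cmod_exp_sum_le mult_right_mono) auto
  show "glue (exp_sum a \<alpha> b \<beta>) (exp_sum c \<gamma> d \<delta>) \<in> L2"
    "(L2_norm (glue (exp_sum a \<alpha> b \<beta>) (exp_sum c \<gamma> d \<delta>)))\<^sup>2
      \<le> (cmod a + cmod b)\<^sup>2 / (2 * r) + (cmod c + cmod d)\<^sup>2 / (2 * q)"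
    using glue_exp_bounded[OF borel_measurable_exp_sum borel_measurable_exp_sum assms(1,2) _ _ f g]
    by simp_all
qed

text \<open>
  On each half-line an exponential with rate \<open>\<alpha>\<close> is an eigenfunction of \<open>- d\<^sup>2/dx\<^sup>2 + V - z\<close> for the
  eigenvalue \<open>V - z - \<alpha>\<^sup>2\<close>, so the operator only rescales the four coefficients.
\<close>

lemma glue_exp_sum_schroedinger:
  fixes \<alpha> \<beta> \<gamma> \<delta> :: complex
  defines "u \<equiv> \<lambda>a b c d. glue (exp_sum a \<alpha> b \<beta>) (exp_sum c \<gamma> d \<delta>)"
  assumes decay: "Re \<alpha> > 0" "Re \<beta> > 0" "Re \<gamma> < 0" "Re \<delta> < 0"
    and match: "a + b = c + d" "a * \<alpha> + b * \<beta> = c * \<gamma> + d * \<delta>"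
  shows glue_exp_sum_in_sobolev_H2: "u a b c d \<in> sobolev_H 2"
    and L2_norm_schroedinger_glue_exp_sum:
      "L2_norm (\<lambda>x. schroedinger Vp Vm (u a b c d) x - z * u a b c d x) =
       L2_norm (u (a * (Vm - z - \<alpha>\<^sup>2)) (b * (Vm - z - \<beta>\<^sup>2)) (c * (Vp - z - \<gamma>\<^sup>2)) (d * (Vp - z - \<delta>\<^sup>2)))"
proof -
  have L2: "u a b c d \<in> L2" for a b c d
    unfolding u_def
    by (rule glue_exp_sum_in_L2[of "min (Re \<alpha>) (Re \<beta>)" "min (- Re \<gamma>) (- Re \<delta>)"]) (use decay in auto)
  note L2' = L2[unfolded u_def]
  have match0: "exp_sum a \<alpha> b \<beta> 0 = exp_sum c \<gamma> d \<delta> 0"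
    "exp_sum (a * \<alpha>) \<alpha> (b * \<beta>) \<beta> 0 = exp_sum (c * \<gamma>) \<gamma> (d * \<delta>) \<delta> 0"
    using match by (simp_all add: exp_sum_def)
  note weak = glue_weak_deriv[OF exp_sum_has_derivative exp_sum_has_derivative continuous_on_exp_sum
      exp_sum_has_derivative exp_sum_has_derivative continuous_on_exp_sum match0 L2' L2' L2']
  have weak2: "AE x in lborel. weak_deriv 2 (u a b c d) x = u (a * \<alpha> * \<alpha>) (b * \<beta> * \<beta>) (c * \<gamma> * \<gamma>) (d * \<delta> * \<delta>) x"
    unfolding u_def by (rule weak(2))
  show "u a b c d \<in> sobolev_H 2"
    unfolding u_def by (rule weak(1))
  then have "weak_deriv 2 (u a b c d) \<in> L2"
    using weak_deriv_in_L2 unfolding sobolev_H_def by blast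
  then have [measurable]: "weak_deriv 2 (u a b c d) \<in> borel_measurable borel"
    by (simp add: L2_def)
  have [measurable]: "u a b c d \<in> borel_measurable borel" for a b c d
    using L2 by (simp add: L2_def)
  have [measurable]: "step_potential Vp Vm \<in> borel_measurable borel"
    unfolding step_potential_def[abs_def] by measurable
  show "L2_norm (\<lambda>x. schroedinger Vp Vm (u a b c d) x - z * u a b c d x) =
       L2_norm (u (a * (Vm - z - \<alpha>\<^sup>2)) (b * (Vm - z - \<beta>\<^sup>2)) (c * (Vp - z - \<gamma>\<^sup>2)) (d * (Vp - z - \<delta>\<^sup>2)))"
  proof (rule L2_norm_cong_AE)
    show "AE x in lborel. schroedinger Vp Vm (u a b c d) x - z * u a b c d x =
      u (a * (Vm - z - \<alpha>\<^sup>2)) (b * (Vm - z - \<beta>\<^sup>2)) (c * (Vp - z - \<gamma>\<^sup>2)) (d * (Vp - z - \<delta>\<^sup>2)) x"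
      using weak2 AE_nonzero
    proof eventually_elim
      case (elim x)
      then consider "x < 0" | "x > 0" by linarith
      then show ?case
        by cases (simp_all add: schroedinger_def elim(1),
          simp_all add: u_def step_potential_def exp_sum_def power2_eq_square algebra_simps)
    qed
  qed (simp_all add: schroedinger_def)
qed

lemma Psi_eq_glue:
  "Psi Vp Vm z = glue (exp_sum (n1 Vp Vm z) (km Vp Vm z) (n2 Vp Vm z) (cnj (km Vp Vm z)))
     (exp_sum (p1 Vp Vm z) (- kp Vp Vm z) (p2 Vp Vm z) (- cnj (kp Vp Vm z)))"
  by (rule ext) (simp add: Psi_def glue_def exp_sum_def)

text \<open>
  The coefficients \<open>n1\<close> and \<open>p1\<close> are the solution of the two linear equations that express continuity
  of the function and of its derivative at the origin, for the given \<open>n2\<close> and \<open>p2\<close>.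
\<close>

lemma Psi_matching:
  assumes "kp Vp Vm z + km Vp Vm z \<noteq> 0"
  shows "n1 Vp Vm z + n2 Vp Vm z = p1 Vp Vm z + p2 Vp Vm z"
    and "n1 Vp Vm z * km Vp Vm z + n2 Vp Vm z * cnj (km Vp Vm z)
       = p1 Vp Vm z * (- kp Vp Vm z) + p2 Vp Vm z * (- cnj (kp Vp Vm z))"
proof -
  define k l S where "k = kp Vp Vm z" and "l = km Vp Vm z" and "S = k + l"
  define a b where "a = complex_of_real \<bar>Im Vp - Im z\<bar>" and "b = complex_of_real \<bar>Im Vm - Im z\<bar>"
  have S: "S \<noteq> 0" using assms by (simp add: S_def k_def l_def)
  have n: "n1 Vp Vm z = ((k + cnj l) * a + (k - cnj k) * b) / S" "n2 Vp Vm z = - a"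
    and p: "p1 Vp Vm z = (- (l - cnj l) * a - (cnj k + l) * b) / S" "p2 Vp Vm z = b"
    by (simp_all add: n1_def n2_def p1_def p2_def k_def l_def a_def b_def S_def divide_inverse algebra_simps)
  show "n1 Vp Vm z + n2 Vp Vm z = p1 Vp Vm z + p2 Vp Vm z"
    unfolding n p using S by (simp add: divide_simps) (simp add: S_def algebra_simps)
  show "n1 Vp Vm z * km Vp Vm z + n2 Vp Vm z * cnj (km Vp Vm z)
       = p1 Vp Vm z * (- kp Vp Vm z) + p2 Vp Vm z * (- cnj (kp Vp Vm z))"
    unfolding n p k_def[symmetric] l_def[symmetric]
    using S by (simp add: divide_simps) (simp add: S_def algebra_simps)
qed

text \<open>
  The exponentials with rates \<open>k\<^sub>-\<close> and \<open>- k\<^sub>+\<close> solve the homogeneous equation exactly.  Those with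
  conjugate rates are multiplied by \<open>w - cnj w = 2 i Im w\<close>, where \<open>w = V\<^sub>\<plusminus> - z = k\<^sub>\<plusminus>\<^sup>2\<close>.
\<close>

lemma Psi_schroedinger:
  assumes "Re (kp Vp Vm z) > 0" "Re (km Vp Vm z) > 0"
  shows Psi_in_sobolev_H2: "Psi Vp Vm z \<in> sobolev_H 2"
    and L2_norm_schroedinger_Psi:
      "L2_norm (\<lambda>x. schroedinger Vp Vm (Psi Vp Vm z) x - z * Psi Vp Vm z x) =
       L2_norm (glue
         (exp_sum 0 (km Vp Vm z) (n2 Vp Vm z * (2 * \<i> * Im (Vm - z))) (cnj (km Vp Vm z)))
         (exp_sum 0 (- kp Vp Vm z) (p2 Vp Vm z * (2 * \<i> * Im (Vp - z))) (- cnj (kp Vp Vm z))))"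
proof -
  have "Re (kp Vp Vm z + km Vp Vm z) > 0" using assms by simp
  then have ne: "kp Vp Vm z + km Vp Vm z \<noteq> 0" by (metis less_irrefl zero_complex.sel(1))
  have sq: "(kp Vp Vm z)\<^sup>2 = Vp - z" "(km Vp Vm z)\<^sup>2 = Vm - z"
    by (simp_all add: kp_def km_def)
  then have sq': "(cnj (kp Vp Vm z))\<^sup>2 = cnj (Vp - z)" "(cnj (km Vp Vm z))\<^sup>2 = cnj (Vm - z)"
    by (metis complex_cnj_power)+
  have im: "w - cnj w = 2 * \<i> * Im w" for w
    by (simp add: complex_eq_iff)
  note action = glue_exp_sum_schroedinger[OF _ _ _ _ Psi_matching[OF ne]]
  show "Psi Vp Vm z \<in> sobolev_H 2"
    unfolding Psi_eq_glue by (rule action(1)) (use assms in auto)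
  have "L2_norm (\<lambda>x. schroedinger Vp Vm (Psi Vp Vm z) x - z * Psi Vp Vm z x) =
    L2_norm (glue
      (exp_sum (n1 Vp Vm z * (Vm - z - (km Vp Vm z)\<^sup>2)) (km Vp Vm z)
         (n2 Vp Vm z * (Vm - z - (cnj (km Vp Vm z))\<^sup>2)) (cnj (km Vp Vm z)))
      (exp_sum (p1 Vp Vm z * (Vp - z - (- kp Vp Vm z)\<^sup>2)) (- kp Vp Vm z)
         (p2 Vp Vm z * (Vp - z - (- cnj (kp Vp Vm z))\<^sup>2)) (- cnj (kp Vp Vm z))))"
    unfolding Psi_eq_glue by (rule action(2)) (use assms in auto)
  then show "L2_norm (\<lambda>x. schroedinger Vp Vm (Psi Vp Vm z) x - z * Psi Vp Vm z x) =
       L2_norm (glue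
         (exp_sum 0 (km Vp Vm z) (n2 Vp Vm z * (2 * \<i> * Im (Vm - z))) (cnj (km Vp Vm z)))
         (exp_sum 0 (- kp Vp Vm z) (p2 Vp Vm z * (2 * \<i> * Im (Vp - z))) (- cnj (kp Vp Vm z))))"
    unfolding power2_minus sq sq' im by simp
qed

section \<open>Decay of the exponentials on the resolvent set\<close>

text \<open>
  A bounded inverse is impossible if functions of arbitrarily large norm have residuals of bounded
  norm.
\<close>

lemma not_in_resolvent_set_if_quasimodes:
  assumes "\<And>\<epsilon>. 0 < \<epsilon> \<Longrightarrow> \<epsilon> \<le> 1 \<Longrightarrow>
    \<exists>u\<in>D. 1 / (2 * \<epsilon>) \<le> (L2_norm u)\<^sup>2 \<and> (L2_norm (\<lambda>x. T u x - z * u x))\<^sup>2 \<le> K"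
  shows "z \<notin> resolvent_set D T"
proof
  assume "z \<in> resolvent_set D T"
  then obtain C where C: "\<And>u. u \<in> D \<Longrightarrow> L2_norm u \<le> C * L2_norm (\<lambda>x. T u x - z * u x)"
    unfolding resolvent_set_def by blast
  have "K \<ge> 0"
    using assms[of 1] zero_le_power2 order_trans by (metis zero_less_one order_refl)
  \<comment> \<open>The bounded inverse forces \<open>1 / (2 * \<epsilon>) \<le> C\<^sup>2 * K\<close>, which this \<open>\<epsilon>\<close> violates by \<open>1\<close>.\<close>
  define \<epsilon> where "\<epsilon> = 1 / (2 * (C\<^sup>2 * K + 1))"
  have pos: "C\<^sup>2 * K \<ge> 0" using \<open>K \<ge> 0\<close> by simp
  then have \<epsilon>: "0 < \<epsilon>" "\<epsilon> \<le> 1" "1 / (2 * \<epsilon>) = C\<^sup>2 * K + 1"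
    by (auto simp: \<epsilon>_def divide_simps)
  obtain u where u: "u \<in> D" "1 / (2 * \<epsilon>) \<le> (L2_norm u)\<^sup>2" "(L2_norm (\<lambda>x. T u x - z * u x))\<^sup>2 \<le> K"
    using assms[OF \<epsilon>(1,2)] by blast
  have "(L2_norm u)\<^sup>2 \<le> (C * L2_norm (\<lambda>x. T u x - z * u x))\<^sup>2"
    by (intro power_mono C u L2_norm_nonneg)
  also have "\<dots> \<le> C\<^sup>2 * K"
    using u(3) by (simp add: power_mult_distrib mult_left_mono)
  finally show False using u(2) \<epsilon>(3) by linarith
qed

text \<open>
  Here \<open>k\<close> is purely imaginary in the application, and the residual consists of two parts.  On the
  half-line where \<open>V - z = W\<close>, the damped oscillation with rate \<open>\<mu>\<close> has squared norm \<open>1/(2\<epsilon>)\<close> but is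
  multiplied by \<open>W - \<mu>\<^sup>2 = O(\<epsilon>)\<close>.  On the other half-line there are two exponentials with rates \<open>1\<close>
  and \<open>2\<close> up to sign, whose coefficients \<open>2 + \<mu>\<close> and \<open>- 1 - \<mu>\<close> stay bounded.
\<close>

lemma quasimode_residual_bound:
  fixes k W W' :: complex
  assumes k: "k\<^sup>2 = W" and \<epsilon>: "0 < \<epsilon>" "\<epsilon> \<le> 1"
  defines "\<mu> \<equiv> k + of_real \<epsilon>"
  shows "(cmod ((2 + \<mu>) * (W' - 1)) + cmod ((- 1 - \<mu>) * (W' - 4)))\<^sup>2 / (2 * 1) + (cmod (W - \<mu>\<^sup>2))\<^sup>2 / (2 * \<epsilon>)
    \<le> ((cmod k + 3) * (cmod W' + 1) + (cmod k + 2) * (cmod W' + 4))\<^sup>2 / 2 + (2 * cmod k + 1)\<^sup>2"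
proof -
  have \<mu>: "cmod \<mu> \<le> cmod k + 1"
    unfolding \<mu>_def using \<epsilon> by (intro order_trans[OF norm_triangle_ineq]) auto
  have "cmod (2 + \<mu>) \<le> cmod k + 3"
    using norm_triangle_ineq[of 2 \<mu>] \<mu> by simp
  moreover have "cmod (- 1 - \<mu>) \<le> cmod k + 2"
    using norm_triangle_ineq4[of "-1" \<mu>] \<mu> by simp
  moreover have "cmod (W' - 1) \<le> cmod W' + 1" "cmod (W' - 4) \<le> cmod W' + 4"
    using norm_triangle_ineq4[of W' 1] norm_triangle_ineq4[of W' 4] by simp_all
  ultimately have "cmod ((2 + \<mu>) * (W' - 1)) + cmod ((- 1 - \<mu>) * (W' - 4)) \<le>
    (cmod k + 3) * (cmod W' + 1) + (cmod k + 2) * (cmod W' + 4)"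
    unfolding norm_mult by (intro add_mono mult_mono) auto
  then have 1: "(cmod ((2 + \<mu>) * (W' - 1)) + cmod ((- 1 - \<mu>) * (W' - 4)))\<^sup>2 \<le>
    ((cmod k + 3) * (cmod W' + 1) + (cmod k + 2) * (cmod W' + 4))\<^sup>2"
    by (intro power_mono) auto
  have "W - \<mu>\<^sup>2 = - (of_real \<epsilon> * (2 * k + of_real \<epsilon>))"
    using k by (simp add: \<mu>_def power2_eq_square algebra_simps)
  then have "cmod (W - \<mu>\<^sup>2) = \<epsilon> * cmod (2 * k + of_real \<epsilon>)"
    using \<epsilon> by (simp add: norm_mult)
  also have "cmod (2 * k + of_real \<epsilon>) \<le> 2 * cmod k + 1"
    using norm_triangle_ineq[of "2 * k" "of_real \<epsilon>"] \<epsilon> by (simp add: norm_mult)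
  finally have "(cmod (W - \<mu>\<^sup>2))\<^sup>2 \<le> (\<epsilon> * (2 * cmod k + 1))\<^sup>2"
    using \<epsilon> by (intro power_mono) auto
  then have "(cmod (W - \<mu>\<^sup>2))\<^sup>2 / (2 * \<epsilon>) \<le> (\<epsilon> * (2 * cmod k + 1))\<^sup>2 / (2 * \<epsilon>)"
    using \<epsilon> by (intro divide_right_mono) auto
  also have "\<dots> = \<epsilon> / 2 * (2 * cmod k + 1)\<^sup>2"
    using \<epsilon> by (simp add: power2_eq_square)
  also have "\<dots> \<le> 1 * (2 * cmod k + 1)\<^sup>2"
    using \<epsilon> by (intro mult_right_mono) auto
  finally show ?thesis using divide_right_mono[OF 1, of 2] by linarith
qed

text \<open>
  If \<open>k\<^sub>+\<close> is purely imaginary, the oscillating solution \<open>e\<^sup>-\<^sup>k\<^sup>x\<close> on the right half-line just fails to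
  be square integrable.  Damping it to \<open>e\<^sup>-\<^sup>\<mu>\<^sup>x\<close> with \<open>\<mu> = k\<^sub>+ + \<epsilon>\<close> gives quasimodes.  They are continued
  to the left by the combination of \<open>e\<^sup>x\<close> and \<open>e\<^sup>2\<^sup>x\<close> that has value \<open>1\<close> and slope \<open>- \<mu>\<close> at the origin.
\<close>

lemma resolvent_set_imp_Re_kp_pos:
  assumes z: "z \<in> resolvent_set dom_schroedinger (schroedinger Vp Vm)"
  shows "Re (kp Vp Vm z) > 0"
proof (rule ccontr)
  define k where "k = kp Vp Vm z"
  define K where "K = ((cmod k + 3) * (cmod (Vm - z) + 1) + (cmod k + 2) * (cmod (Vm - z) + 4))\<^sup>2 / 2 + (2 * cmod k + 1)\<^sup>2"
  assume "\<not> Re (kp Vp Vm z) > 0"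
  then have Re_k: "Re k = 0"
    using csqrt_principal[of "Vp - z"] by (auto simp: k_def kp_def)
  have k: "k\<^sup>2 = Vp - z" by (simp add: k_def kp_def)
  have "z \<notin> resolvent_set dom_schroedinger (schroedinger Vp Vm)"
  proof (rule not_in_resolvent_set_if_quasimodes)
    fix \<epsilon> :: real assume \<epsilon>: "0 < \<epsilon>" "\<epsilon> \<le> 1"
    define \<mu> where "\<mu> = k + of_real \<epsilon>"
    have Re_\<mu>: "Re \<mu> = \<epsilon>" by (simp add: \<mu>_def Re_k)
    define u where "u a b c = glue (exp_sum a 1 b 2) (exp_sum c (- \<mu>) 0 (- \<mu>))" for a b c
    have u_le: "(L2_norm (u a b c))\<^sup>2 \<le> (cmod a + cmod b)\<^sup>2 / (2 * 1) + (cmod c + cmod 0)\<^sup>2 / (2 * \<epsilon>)"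
      and u_L2: "u a b c \<in> L2" for a b c
      unfolding u_def
      by (rule L2_norm_glue_exp_sum_le, use \<epsilon> Re_\<mu> in simp_all)
        (rule glue_exp_sum_in_L2[of 1 \<epsilon>], use \<epsilon> Re_\<mu> in simp_all)
    let ?u = "u (2 + \<mu>) (- 1 - \<mu>) 1"
    have H2: "?u \<in> sobolev_H 2"
      and res: "L2_norm (\<lambda>x. schroedinger Vp Vm ?u x - z * ?u x) =
        L2_norm (u ((2 + \<mu>) * (Vm - z - 1\<^sup>2)) ((- 1 - \<mu>) * (Vm - z - 2\<^sup>2)) (1 * (Vp - z - (- \<mu>)\<^sup>2)))"
      using glue_exp_sum_in_sobolev_H2[of 1 2 "- \<mu>" "- \<mu>" "2 + \<mu>" "- 1 - \<mu>" 1 0]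
        L2_norm_schroedinger_glue_exp_sum[of 1 2 "- \<mu>" "- \<mu>" "2 + \<mu>" "- 1 - \<mu>" 1 0 Vp Vm z] Re_\<mu> \<epsilon>
      by (simp_all add: u_def)
    have "(L2_norm (\<lambda>x. schroedinger Vp Vm ?u x - z * ?u x))\<^sup>2 \<le> K"
      unfolding res K_def power2_minus
      by (rule order_trans[OF u_le])
        (use quasimode_residual_bound[OF k \<epsilon>, of "Vm - z"] in \<open>simp add: \<mu>_def\<close>)
    moreover have "0\<^sup>2 / (2 * 1) + 1\<^sup>2 / (2 * \<epsilon>) \<le> (L2_norm ?u)\<^sup>2"
      unfolding u_def
    proof (rule L2_norm_glue_ge)
      show "1 * exp (- \<epsilon> * x) \<le> cmod (exp_sum 1 (- \<mu>) 0 (- \<mu>) x)" for x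
        using cmod_exp_sum_ge[of "- \<mu>" x "- \<epsilon> * x" "- \<mu>" 1 0] Re_\<mu> by simp
    qed (use u_L2[unfolded u_def] \<epsilon> in auto)
    ultimately show "\<exists>u\<in>dom_schroedinger. 1 / (2 * \<epsilon>) \<le> (L2_norm u)\<^sup>2 \<and>
        (L2_norm (\<lambda>x. schroedinger Vp Vm u x - z * u x))\<^sup>2 \<le> K"
      using H2 by (intro bexI[of _ ?u]) simp_all
  qed
  with z show False by simp
qed

text \<open>
  The mirror image of the preceding argument: the damped oscillation lives on the left half-line.
\<close>

lemma resolvent_set_imp_Re_km_pos:
  assumes z: "z \<in> resolvent_set dom_schroedinger (schroedinger Vp Vm)"
  shows "Re (km Vp Vm z) > 0"
proof (rule ccontr)
  define k where "k = km Vp Vm z"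
  define K where "K = ((cmod k + 3) * (cmod (Vp - z) + 1) + (cmod k + 2) * (cmod (Vp - z) + 4))\<^sup>2 / 2 + (2 * cmod k + 1)\<^sup>2"
  assume "\<not> Re (km Vp Vm z) > 0"
  then have Re_k: "Re k = 0"
    using csqrt_principal[of "Vm - z"] by (auto simp: k_def km_def)
  have k: "k\<^sup>2 = Vm - z" by (simp add: k_def km_def)
  have "z \<notin> resolvent_set dom_schroedinger (schroedinger Vp Vm)"
  proof (rule not_in_resolvent_set_if_quasimodes)
    fix \<epsilon> :: real assume \<epsilon>: "0 < \<epsilon>" "\<epsilon> \<le> 1"
    define \<mu> where "\<mu> = k + of_real \<epsilon>"
    have Re_\<mu>: "Re \<mu> = \<epsilon>" by (simp add: \<mu>_def Re_k)
    define u where "u a b c = glue (exp_sum c \<mu> 0 \<mu>) (exp_sum a (- 1) b (- 2))" for a b c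
    have u_le: "(L2_norm (u a b c))\<^sup>2 \<le> (cmod c + cmod 0)\<^sup>2 / (2 * \<epsilon>) + (cmod a + cmod b)\<^sup>2 / (2 * 1)"
      and u_L2: "u a b c \<in> L2" for a b c
      unfolding u_def
      by (rule L2_norm_glue_exp_sum_le, use \<epsilon> Re_\<mu> in simp_all)
        (rule glue_exp_sum_in_L2[of \<epsilon> 1], use \<epsilon> Re_\<mu> in simp_all)
    let ?u = "u (2 + \<mu>) (- 1 - \<mu>) 1"
    have H2: "?u \<in> sobolev_H 2"
      and res: "L2_norm (\<lambda>x. schroedinger Vp Vm ?u x - z * ?u x) =
        L2_norm (u ((2 + \<mu>) * (Vp - z - (- 1)\<^sup>2)) ((- 1 - \<mu>) * (Vp - z - (- 2)\<^sup>2)) (1 * (Vm - z - \<mu>\<^sup>2)))"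
      using glue_exp_sum_in_sobolev_H2[of \<mu> \<mu> "- 1" "- 2" 1 0 "2 + \<mu>" "- 1 - \<mu>"]
        L2_norm_schroedinger_glue_exp_sum[of \<mu> \<mu> "- 1" "- 2" 1 0 "2 + \<mu>" "- 1 - \<mu>" Vp Vm z] Re_\<mu> \<epsilon>
      by (simp_all add: u_def)
    have "(L2_norm (\<lambda>x. schroedinger Vp Vm ?u x - z * ?u x))\<^sup>2 \<le> K"
      unfolding res K_def
      by (rule order_trans[OF u_le])
        (use quasimode_residual_bound[OF k \<epsilon>, of "Vp - z"] in \<open>simp add: \<mu>_def add.commute\<close>)
    moreover have "1\<^sup>2 / (2 * \<epsilon>) + 0\<^sup>2 / (2 * 1) \<le> (L2_norm ?u)\<^sup>2"
      unfolding u_def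
    proof (rule L2_norm_glue_ge)
      show "1 * exp (\<epsilon> * x) \<le> cmod (exp_sum 1 \<mu> 0 \<mu> x)" for x
        using cmod_exp_sum_ge[of \<mu> x "\<epsilon> * x" \<mu> 1 0] Re_\<mu> by simp
    qed (use u_L2[unfolded u_def] \<epsilon> in auto)
    ultimately show "\<exists>u\<in>dom_schroedinger. 1 / (2 * \<epsilon>) \<le> (L2_norm u)\<^sup>2 \<and>
        (L2_norm (\<lambda>x. schroedinger Vp Vm u x - z * u x))\<^sup>2 \<le> K"
      using H2 by (intro bexI[of _ ?u]) simp_all
  qed
  with z show False by simp
qed

section \<open>Asymptotics of the norms\<close>

text \<open>
  For \<open>v = - s\<^sup>2 + O(1)\<close> the product of \<open>k - i \<sigma> s\<close> and \<open>k + i \<sigma> s\<close> is \<open>v + s\<^sup>2\<close>, where \<open>k\<close> is the root of \<open>v\<close>.  If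
  \<open>\<sigma>\<close> is the sign of \<open>Im v\<close>, it is also the sign of \<open>Im k\<close>, so the second factor is at least \<open>s\<close> in
  absolute value and the first is \<open>O(1/s)\<close>.
\<close>

lemma csqrt_close_to_imaginary_axis:
  fixes \<sigma> s :: real
  assumes "\<bar>\<sigma>\<bar> = 1" "\<sigma> * Im v > 0" "s > 0"
  shows "Re (csqrt v) > 0" and "cmod (csqrt v - \<i> * of_real (\<sigma> * s)) \<le> cmod (v + of_real (s\<^sup>2)) / s"
proof -
  define k where "k = csqrt v"
  have v: "v = k\<^sup>2" by (simp add: k_def)
  then have Im_v: "Im v = 2 * (Re k * Im k)"
    by (simp add: Im_power2)
  with assms have "Re k \<noteq> 0" by auto
  then have pos: "Re k > 0"
    using csqrt_principal[of v] by (auto simp flip: k_def)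
  then show "Re (csqrt v) > 0" by (simp only: k_def)
  have "Re k * (\<sigma> * Im k) > 0"
    using assms(2) Im_v by (simp add: algebra_simps)
  then have "\<sigma> * Im k > 0"
    using pos by (simp add: zero_less_mult_iff)
  have \<sigma>2: "\<sigma>\<^sup>2 = 1"
    using assms(1) by (metis power2_abs one_power2)
  have "s \<le> \<bar>\<sigma> * Im k + \<sigma>\<^sup>2 * s\<bar>"
    using \<open>\<sigma> * Im k > 0\<close> \<sigma>2 by simp
  also have "\<dots> = \<bar>\<sigma>\<bar> * \<bar>Im k + \<sigma> * s\<bar>"
    by (simp add: power2_eq_square distrib_left flip: abs_mult)
  also have "\<dots> = \<bar>Im (k + \<i> * of_real (\<sigma> * s))\<bar>"
    using assms(1) by simp
  also have "\<dots> \<le> cmod (k + \<i> * of_real (\<sigma> * s))"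
    by (rule abs_Im_le_cmod)
  finally have far: "s \<le> cmod (k + \<i> * of_real (\<sigma> * s))" .
  have "(k - \<i> * of_real (\<sigma> * s)) * (k + \<i> * of_real (\<sigma> * s)) = k\<^sup>2 + of_real (\<sigma>\<^sup>2 * s\<^sup>2)"
    by (simp add: algebra_simps power2_eq_square)
  also have "\<dots> = v + of_real (s\<^sup>2)"
    using \<sigma>2 v by simp
  finally have "cmod (k - \<i> * of_real (\<sigma> * s)) * cmod (k + \<i> * of_real (\<sigma> * s)) = cmod (v + of_real (s\<^sup>2))"
    by (metis norm_mult)
  moreover have "cmod (k - \<i> * of_real (\<sigma> * s)) * s \<le>
      cmod (k - \<i> * of_real (\<sigma> * s)) * cmod (k + \<i> * of_real (\<sigma> * s))"
    by (intro mult_left_mono far) auto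
  ultimately show "cmod (csqrt v - \<i> * of_real (\<sigma> * s)) \<le> cmod (v + of_real (s\<^sup>2)) / s"
    unfolding k_def[symmetric] using \<open>s > 0\<close> by (simp add: pos_le_divide_eq)
qed

lemma cmod_mult_perturbation:
  assumes P: "cmod (P - of_real D * w) \<le> D * \<delta>" and Q: "cmod (Q - w) \<le> \<delta>" and "D \<ge> 0"
  shows "\<bar>cmod (P * Q) - D * (cmod w)\<^sup>2\<bar> \<le> D * \<delta> * (2 * cmod w + \<delta>)"
proof -
  define E F where "E = P - of_real D * w" and "F = Q - w"
  have "P * Q - of_real D * w\<^sup>2 = of_real D * w * F + E * w + E * F"
    by (simp add: E_def F_def algebra_simps power2_eq_square)
  also have "cmod \<dots> \<le> cmod (of_real D * w * F) + cmod (E * w) + cmod (E * F)"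
    by (intro norm_triangle_le add_right_mono norm_triangle_ineq)
  also have "\<dots> \<le> D * cmod w * \<delta> + D * \<delta> * cmod w + D * \<delta> * \<delta>"
  proof -
    have "cmod E \<le> D * \<delta>" "cmod F \<le> \<delta>" using P Q by (simp_all add: E_def F_def)
    moreover from this have "0 \<le> \<delta>" using norm_ge_zero order_trans by blast
    ultimately show ?thesis
      unfolding norm_mult norm_of_real using \<open>D \<ge> 0\<close>
      by (intro add_mono[OF add_mono] mult_mono mult_nonneg_nonneg) auto
  qed
  finally have "cmod (P * Q - of_real D * w\<^sup>2) \<le> D * \<delta> * (2 * cmod w + \<delta>)"
    by (simp add: algebra_simps)
  moreover have "\<bar>cmod (P * Q) - cmod (of_real D * w\<^sup>2)\<bar> \<le> cmod (P * Q - of_real D * w\<^sup>2)"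
    by (rule norm_triangle_ineq3)
  moreover have "cmod (of_real D * w\<^sup>2) = D * (cmod w)\<^sup>2"
    using \<open>D \<ge> 0\<close> by (simp add: norm_mult norm_power)
  ultimately show ?thesis by linarith
qed

text \<open>
  The denominator \<open>k\<^sub>+ + k\<^sub>-\<close> is small because its leading terms \<open>w\<close> and \<open>- w\<close> cancel.  It is
  eliminated by \<open>(k\<^sub>+ + k\<^sub>-) (k\<^sub>+ - k\<^sub>-) = V\<^sub>+ - V\<^sub>-\<close>, which turns \<open>(V\<^sub>+ - V\<^sub>-) n1\<close> into the product of a
  numerator close to \<open>2 (A + B) w\<close> and of \<open>k\<^sub>+ - k\<^sub>-\<close>, which is close to \<open>2 w\<close>; likewise for \<open>p1\<close>.
\<close>

lemma Psi_leading_coefficients: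
  fixes Vp Vm z :: complex
  defines "A \<equiv> \<bar>Im Vp - Im z\<bar>" and "B \<equiv> \<bar>Im Vm - Im z\<bar>"
  assumes ne: "kp Vp Vm z + km Vp Vm z \<noteq> 0"
    and w: "cnj w = - w"
    and k: "cmod (kp Vp Vm z - w) \<le> \<delta>" and l: "cmod (km Vp Vm z + w) \<le> \<delta>"
  shows "\<bar>cmod (Vp - Vm) * cmod (n1 Vp Vm z) - 4 * (A + B) * (cmod w)\<^sup>2\<bar> \<le> 4 * (A + B) * \<delta> * (2 * cmod w + \<delta>)"
    and "\<bar>cmod (Vp - Vm) * cmod (p1 Vp Vm z) - 4 * (A + B) * (cmod w)\<^sup>2\<bar> \<le> 4 * (A + B) * \<delta> * (2 * cmod w + \<delta>)"
proof -
  define k l where "k = kp Vp Vm z" and "l = km Vp Vm z"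
  define e f where "e = k - w" and "f = l + w"
  have ef: "cmod e \<le> \<delta>" "cmod f \<le> \<delta>"
    using assms by (simp_all add: e_def f_def k_def l_def)
  have kl: "k = w + e" "l = f - w" by (simp_all add: e_def f_def)
  have "k + l \<noteq> 0" using ne by (simp add: k_def l_def)
  have AB: "A \<ge> 0" "B \<ge> 0" by (simp_all add: A_def B_def)
  have "(k + l) * (k - l) = k\<^sup>2 - l\<^sup>2"
    by (simp add: power2_eq_square algebra_simps)
  also have "\<dots> = Vp - Vm"
    by (simp add: k_def l_def kp_def km_def)
  finally have prod: "Vp - Vm = (k + l) * (k - l)" ..
  define Pn where "Pn = (k + cnj l) * of_real A + (k - cnj k) * of_real B"
  define Pp where "Pp = (cnj l - l) * of_real A - (cnj k + l) * of_real B"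
  have n: "n1 Vp Vm z = Pn / (k + l)" and p: "p1 Vp Vm z = Pp / (k + l)"
    by (simp_all add: n1_def p1_def k_def l_def A_def B_def Pn_def Pp_def divide_inverse algebra_simps)
  have "(Vp - Vm) * n1 Vp Vm z = Pn * (k - l)" "(Vp - Vm) * p1 Vp Vm z = Pp * (k - l)"
    unfolding prod n p using \<open>k + l \<noteq> 0\<close> by simp_all
  then have cmods: "cmod (Vp - Vm) * cmod (n1 Vp Vm z) = cmod (Pn * (k - l))"
      "cmod (Vp - Vm) * cmod (p1 Vp Vm z) = cmod (Pp * (k - l))"
    by (metis norm_mult)+
  have weighted: "cmod (a * of_real A + b * of_real B) \<le> (A + B) * (2 * \<delta>)"
    if "cmod a \<le> 2 * \<delta>" "cmod b \<le> 2 * \<delta>" for a b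
  proof -
    have "cmod (a * of_real A + b * of_real B) \<le> cmod a * A + cmod b * B"
      using AB norm_triangle_ineq[of "a * of_real A" "b * of_real B"] by (simp add: norm_mult)
    also have "\<dots> \<le> 2 * \<delta> * A + 2 * \<delta> * B"
      using that AB by (intro add_mono mult_right_mono)
    finally show ?thesis by (simp add: algebra_simps)
  qed
  have sum2: "cmod (a + b) \<le> 2 * \<delta>" if "cmod a \<le> \<delta>" "cmod b \<le> \<delta>" for a b
    using norm_triangle_ineq[of a b] that by linarith
  have diff2: "cmod (a - b) \<le> 2 * \<delta>" if "cmod a \<le> \<delta>" "cmod b \<le> \<delta>" for a b
    using norm_triangle_ineq4[of a b] that by linarith
  have Q: "cmod ((k - l) - 2 * w) \<le> 2 * \<delta>"
    using diff2[OF ef] by (simp add: kl algebra_simps)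
  have "Pn - of_real (A + B) * (2 * w) = (e + cnj f) * of_real A + (e - cnj e) * of_real B"
    by (simp add: Pn_def kl w algebra_simps)
  also have "cmod \<dots> \<le> (A + B) * (2 * \<delta>)"
    using ef by (intro weighted sum2 diff2) auto
  finally have Pn: "cmod (Pn - of_real (A + B) * (2 * w)) \<le> (A + B) * (2 * \<delta>)" .
  have "Pp - of_real (A + B) * (2 * w) = (cnj f - f) * of_real A + (- cnj e - f) * of_real B"
    by (simp add: Pp_def kl w algebra_simps)
  also have "cmod \<dots> \<le> (A + B) * (2 * \<delta>)"
    using ef by (intro weighted diff2) auto
  finally have Pp: "cmod (Pp - of_real (A + B) * (2 * w)) \<le> (A + B) * (2 * \<delta>)" .
  show "\<bar>cmod (Vp - Vm) * cmod (n1 Vp Vm z) - 4 * (A + B) * (cmod w)\<^sup>2\<bar> \<le> 4 * (A + B) * \<delta> * (2 * cmod w + \<delta>)"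
    using cmod_mult_perturbation[OF Pn Q] AB
    by (simp add: cmods norm_mult power_mult_distrib algebra_simps)
  show "\<bar>cmod (Vp - Vm) * cmod (p1 Vp Vm z) - 4 * (A + B) * (cmod w)\<^sup>2\<bar> \<le> 4 * (A + B) * \<delta> * (2 * cmod w + \<delta>)"
    using cmod_mult_perturbation[OF Pp Q] AB
    by (simp add: cmods norm_mult power_mult_distrib algebra_simps)
qed

text \<open>
  The two exponentials on each side have conjugate rates and hence the same modulus, so pointwise
  the modulus of \<open>\<Psi>\<close> lies between the difference and the sum of the moduli of the coefficients,
  times a real exponential.  Thus one coefficient of size \<open>m\<close> on either side determines the norm up
  to the factor \<open>\<surd>T\<close>, which the residual has as well.
\<close>

lemma L2_norm_Psi_bounds:
  fixes Vp Vm z :: complex and c m :: real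
  defines "T \<equiv> 1 / (2 * Re (km Vp Vm z)) + 1 / (2 * Re (kp Vp Vm z))"
  assumes Re: "Re (kp Vp Vm z) > 0" "Re (km Vp Vm z) > 0"
    and n: "\<bar>cmod (n1 Vp Vm z) - m\<bar> + cmod (n2 Vp Vm z) \<le> c"
    and p: "\<bar>cmod (p1 Vp Vm z) - m\<bar> + cmod (p2 Vp Vm z) \<le> c"
    and "c \<le> m"
  shows "(m - c) * sqrt T \<le> L2_norm (Psi Vp Vm z)" and "L2_norm (Psi Vp Vm z) \<le> (m + c) * sqrt T"
proof -
  let ?f = "exp_sum (n1 Vp Vm z) (km Vp Vm z) (n2 Vp Vm z) (cnj (km Vp Vm z))"
  let ?g = "exp_sum (p1 Vp Vm z) (- kp Vp Vm z) (p2 Vp Vm z) (- cnj (kp Vp Vm z))"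
  have T: "T \<ge> 0" using Re by (simp add: T_def)
  have c: "c \<ge> 0" using n by (smt (verit) norm_ge_zero)
  have "cmod (n1 Vp Vm z) + cmod (n2 Vp Vm z) \<le> m + c" "cmod (p1 Vp Vm z) + cmod (p2 Vp Vm z) \<le> m + c"
    using n p by linarith+
  then have "(cmod (n1 Vp Vm z) + cmod (n2 Vp Vm z))\<^sup>2 / (2 * Re (km Vp Vm z))
      + (cmod (p1 Vp Vm z) + cmod (p2 Vp Vm z))\<^sup>2 / (2 * Re (kp Vp Vm z))
      \<le> (m + c)\<^sup>2 / (2 * Re (km Vp Vm z)) + (m + c)\<^sup>2 / (2 * Re (kp Vp Vm z))"
    using Re by (intro add_mono[OF divide_right_mono[OF power_mono] divide_right_mono[OF power_mono]]) auto
  then have "(L2_norm (Psi Vp Vm z))\<^sup>2 \<le> (m + c)\<^sup>2 * T"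
    unfolding Psi_eq_glue T_def using Re
    by (intro order_trans[OF L2_norm_glue_exp_sum_le[of "Re (km Vp Vm z)" "Re (kp Vp Vm z)"]])
      (auto simp: algebra_simps)
  then have "(L2_norm (Psi Vp Vm z))\<^sup>2 \<le> ((m + c) * sqrt T)\<^sup>2"
    using T by (simp add: power_mult_distrib)
  then show "L2_norm (Psi Vp Vm z) \<le> (m + c) * sqrt T"
    by (rule power2_le_imp_le) (use c \<open>c \<le> m\<close> T in auto)
  have "(m - c)\<^sup>2 / (2 * Re (km Vp Vm z)) + (m - c)\<^sup>2 / (2 * Re (kp Vp Vm z)) \<le> (L2_norm (Psi Vp Vm z))\<^sup>2"
    unfolding Psi_eq_glue
  proof (rule L2_norm_glue_ge)
    show "glue ?f ?g \<in> L2"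
      by (rule glue_exp_sum_in_L2[of "Re (km Vp Vm z)" "Re (kp Vp Vm z)"]) (use Re in auto)
    have "m - c \<le> cmod (n1 Vp Vm z) - cmod (n2 Vp Vm z)" "m - c \<le> cmod (p1 Vp Vm z) - cmod (p2 Vp Vm z)"
      using n p by linarith+
    then show "(m - c) * exp (Re (km Vp Vm z) * x) \<le> cmod (?f x)"
      and "(m - c) * exp (- Re (kp Vp Vm z) * x) \<le> cmod (?g x)" for x
      by (auto intro!: order_trans[OF mult_right_mono cmod_exp_sum_ge])
  qed (use Re \<open>c \<le> m\<close> in auto)
  moreover have "((m - c) * sqrt T)\<^sup>2 = (m - c)\<^sup>2 / (2 * Re (km Vp Vm z)) + (m - c)\<^sup>2 / (2 * Re (kp Vp Vm z))"
    using T by (simp add: power_mult_distrib) (simp add: T_def distrib_left)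
  ultimately have "((m - c) * sqrt T)\<^sup>2 \<le> (L2_norm (Psi Vp Vm z))\<^sup>2"
    by (simp only:)
  then show "(m - c) * sqrt T \<le> L2_norm (Psi Vp Vm z)"
    by (rule power2_le_imp_le) (rule L2_norm_nonneg)
qed

text \<open>
  The residual is a single exponential on each side.  The weights \<open>n2\<close> and \<open>p2\<close> are such that both
  amplitudes have the same modulus; therefore the norm is an exact multiple of the same \<open>\<surd>T\<close>.
\<close>

lemma L2_norm_schroedinger_Psi_eq:
  fixes Vp Vm z :: complex
  defines "T \<equiv> 1 / (2 * Re (km Vp Vm z)) + 1 / (2 * Re (kp Vp Vm z))"
  assumes Re: "Re (kp Vp Vm z) > 0" "Re (km Vp Vm z) > 0"
  shows "L2_norm (\<lambda>x. schroedinger Vp Vm (Psi Vp Vm z) x - z * Psi Vp Vm z x) =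
    2 * \<bar>Im Vp - Im z\<bar> * \<bar>Im Vm - Im z\<bar> * sqrt T" (is "?N = _")
proof -
  define c where "c = 2 * \<bar>Im Vp - Im z\<bar> * \<bar>Im Vm - Im z\<bar>"
  have c: "cmod (n2 Vp Vm z * (2 * \<i> * Im (Vm - z))) = c" "cmod (p2 Vp Vm z * (2 * \<i> * Im (Vp - z))) = c"
    by (simp_all add: n2_def p2_def norm_mult c_def flip: of_real_diff)
  have T: "T \<ge> 0" using Re by (simp add: T_def)
  let ?a = "n2 Vp Vm z * (2 * \<i> * Im (Vm - z))" and ?b = "p2 Vp Vm z * (2 * \<i> * Im (Vp - z))"
  let ?f = "exp_sum 0 (km Vp Vm z) ?a (cnj (km Vp Vm z))"
  let ?g = "exp_sum 0 (- kp Vp Vm z) ?b (- cnj (kp Vp Vm z))"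
  have split: "(c * sqrt T)\<^sup>2 = c\<^sup>2 / (2 * Re (km Vp Vm z)) + c\<^sup>2 / (2 * Re (kp Vp Vm z))"
    using T by (simp add: power_mult_distrib) (simp add: T_def algebra_simps)
  have "?N\<^sup>2 \<le> (cmod 0 + cmod ?a)\<^sup>2 / (2 * Re (km Vp Vm z)) + (cmod 0 + cmod ?b)\<^sup>2 / (2 * Re (kp Vp Vm z))"
    unfolding L2_norm_schroedinger_Psi[OF Re] using Re by (intro L2_norm_glue_exp_sum_le) auto
  moreover have "c\<^sup>2 / (2 * Re (km Vp Vm z)) + c\<^sup>2 / (2 * Re (kp Vp Vm z)) \<le> ?N\<^sup>2"
    unfolding L2_norm_schroedinger_Psi[OF Re]
  proof (rule L2_norm_glue_ge)
    show "glue ?f ?g \<in> L2"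
      by (rule glue_exp_sum_in_L2[of "Re (km Vp Vm z)" "Re (kp Vp Vm z)"]) (use Re in auto)
    show "c * exp (Re (km Vp Vm z) * x) \<le> cmod (?f x)"
      and "c * exp (- Re (kp Vp Vm z) * x) \<le> cmod (?g x)" for x
      using c by (simp_all add: exp_sum_def norm_mult)
  qed (use Re in \<open>auto simp: c_def\<close>)
  ultimately have "?N\<^sup>2 = (c * sqrt T)\<^sup>2"
    unfolding split c norm_zero add_0 by (rule antisym)
  then show ?thesis
    using T by (simp add: L2_norm_nonneg c_def)
qed

lemma relative_error_le:
  fixes m c q :: real
  assumes "m > 0" "2 * c \<le> m" "c \<ge> 0" "m - c \<le> q" "q \<le> m + c"
  shows "\<bar>m / q - 1\<bar> \<le> 2 * c / m"
proof -
  have q: "q \<ge> m / 2" "q > 0" using assms by linarith+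
  have "\<bar>m / q - 1\<bar> = \<bar>m - q\<bar> / q"
    using q by (simp add: field_simps abs_divide)
  also have "\<dots> \<le> c / (m / 2)"
    using assms q by (intro frac_le) auto
  finally show ?thesis by (simp add: mult.commute)
qed

theorem theorem2p9:
  fixes Vp Vm :: complex
  assumes "Im Vp \<noteq> Im Vm"
  shows "(\<forall>z \<in> resolvent_set dom_schroedinger (schroedinger Vp Vm). Psi Vp Vm z \<in> sobolev_H 2) \<and>
    (\<exists>M>0. \<exists>C>0. \<forall>z. Re z \<ge> M \<and> Im z \<in> {min (Im Vp) (Im Vm)<..<max (Im Vp) (Im Vm)} \<longrightarrow>
       \<bar>(L2_norm (\<lambda>x. schroedinger Vp Vm (Psi Vp Vm z) x - z * Psi Vp Vm z x) / L2_norm (Psi Vp Vm z))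
         / (cmod (Vp - Vm) / (2 * \<bar>Im Vp - Im Vm\<bar>)
              * (\<bar>Im Vp - Im z\<bar> * \<bar>Im Vm - Im z\<bar> / Re z)) - 1\<bar>
       \<le> C / \<bar>Re z\<bar>)"
proof
  show "\<forall>z \<in> resolvent_set dom_schroedinger (schroedinger Vp Vm). Psi Vp Vm z \<in> sobolev_H 2"
    by (intro ballI Psi_in_sobolev_H2 resolvent_set_imp_Re_kp_pos resolvent_set_imp_Re_km_pos)
  define D where "D = \<bar>Im Vp - Im Vm\<bar>"
  define J where "J = cmod (Vp - Vm)"
  define K where "K = \<bar>Re Vp\<bar> + \<bar>Re Vm\<bar> + D"
  \<comment> \<open>\<open>c\<close> bounds \<open>| |n1| - m | + |n2|\<close>; its first part is the error in \<open>n1\<close>, its second part bounds \<open>n2\<close>.\<close>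
  define c where "c = 4 * D * K * (2 + K) / J + D"
  \<comment> \<open>With this \<open>C\<close> the relative error \<open>2 c / m\<close> is \<open>C / Re z\<close>, and \<open>Re z \<ge> C\<close> means \<open>2 c \<le> m\<close>.\<close>
  define C where "C = c * J / (2 * D)"
  have D: "D > 0" and J: "J > 0"
    using assms by (auto simp: D_def J_def)
  then have K: "K > 0" by (simp add: K_def)
  have c: "c > 0" using D J K by (auto simp: c_def intro!: add_nonneg_pos)
  have C: "C > 0" using c D J by (simp add: C_def)
  have main: "\<bar>(L2_norm (\<lambda>x. schroedinger Vp Vm (Psi Vp Vm z) x - z * Psi Vp Vm z x) / L2_norm (Psi Vp Vm z))
         / (J / (2 * D) * (\<bar>Im Vp - Im z\<bar> * \<bar>Im Vm - Im z\<bar> / Re z)) - 1\<bar> \<le> C / \<bar>Re z\<bar>"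
    if x: "Re z \<ge> max 1 C" and y: "Im z \<in> {min (Im Vp) (Im Vm)<..<max (Im Vp) (Im Vm)}" for z
  proof -
    define A B s where "A = \<bar>Im Vp - Im z\<bar>" and "B = \<bar>Im Vm - Im z\<bar>" and "s = sqrt (Re z)"
    \<comment> \<open>The two square roots lie near opposite points \<open>\<plusminus>w\<close> of the imaginary axis because \<open>Im z\<close> separates \<open>Im V\<^sub>+\<close> from \<open>Im V\<^sub>-\<close>.\<close>
    define \<sigma> where "\<sigma> = sgn (Im (Vp - z))"
    define w where "w = \<i> * of_real (\<sigma> * s)"
    define m where "m = 4 * D * Re z / J"
    define T where "T = 1 / (2 * Re (km Vp Vm z)) + 1 / (2 * Re (kp Vp Vm z))"
    have AB: "A > 0" "B > 0" "A + B = D"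
      using y by (auto simp: A_def B_def D_def min_def max_def split: if_splits)
    have \<sigma>: "\<bar>\<sigma>\<bar> = 1" "\<sigma> * Im (Vp - z) > 0" "- \<sigma> * Im (Vm - z) > 0"
      using y by (auto simp: \<sigma>_def sgn_if min_def max_def split: if_splits)
    have s: "s \<ge> 1" "s\<^sup>2 = Re z" "s > 0"
      using x by (auto simp: s_def)
    have close: "cmod (V - z + of_real (s\<^sup>2)) \<le> K" if "V = Vp \<or> V = Vm" for V
    proof -
      have "cmod (V - z + of_real (s\<^sup>2)) \<le> \<bar>Re (V - z + of_real (s\<^sup>2))\<bar> + \<bar>Im (V - z + of_real (s\<^sup>2))\<bar>"
        by (rule cmod_le)
      also have "\<dots> \<le> K"
        using that AB unfolding s(2) by (auto simp: K_def A_def B_def)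
      finally show ?thesis .
    qed
    have k: "Re (kp Vp Vm z) > 0" "cmod (kp Vp Vm z - w) \<le> K / s"
      using csqrt_close_to_imaginary_axis[OF \<sigma>(1,2) s(3)] divide_right_mono[OF close[of Vp], of s] s(3)
      by (auto simp: kp_def w_def)
    have l: "Re (km Vp Vm z) > 0" "cmod (km Vp Vm z + w) \<le> K / s"
      using csqrt_close_to_imaginary_axis[of "- \<sigma>", OF _ \<sigma>(3) s(3)] divide_right_mono[OF close[of Vm], of s] s(3) \<sigma>(1)
      by (auto simp: km_def w_def)
    have ne: "kp Vp Vm z + km Vp Vm z \<noteq> 0"
      using k(1) l(1) by (metis add_pos_pos less_irrefl plus_complex.sel(1) zero_complex.sel(1))
    have w: "cnj w = - w" "cmod w = s"
      using \<sigma>(1) s(3) by (simp_all add: w_def norm_mult abs_mult)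
    have "4 * (A + B) * (K / s) * (2 * cmod w + K / s) = 4 * D * K * (2 + K / s\<^sup>2)"
      using s(3) unfolding w(2) AB(3) by (simp add: field_simps power2_eq_square)
    also have "\<dots> \<le> 4 * D * K * (2 + K)"
    proof -
      have "K / s\<^sup>2 \<le> K / 1"
        using K x s(2) by (intro divide_left_mono) auto
      then show ?thesis using D K by simp
    qed
    finally have err: "4 * (A + B) * (K / s) * (2 * cmod w + K / s) \<le> 4 * D * K * (2 + K)" .
    have coeff: "\<bar>q - m\<bar> \<le> 4 * D * K * (2 + K) / J"
      if "\<bar>J * q - 4 * (A + B) * (cmod w)\<^sup>2\<bar> \<le> 4 * (A + B) * (K / s) * (2 * cmod w + K / s)" for q
    proof -
      have "J * (q - m) = J * q - 4 * (A + B) * (cmod w)\<^sup>2"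
        using J unfolding w(2) AB(3) s(2) by (simp add: m_def algebra_simps)
      then have "J * \<bar>q - m\<bar> \<le> 4 * D * K * (2 + K)"
        using that err J by (metis abs_mult abs_of_pos order_trans)
      then show ?thesis using J by (simp add: pos_le_divide_eq mult.commute)
    qed
    note lead = Psi_leading_coefficients[OF ne w(1) k(2) l(2), folded A_def B_def J_def, THEN coeff]
    have "\<bar>cmod (n1 Vp Vm z) - m\<bar> + cmod (n2 Vp Vm z) \<le> c" "\<bar>cmod (p1 Vp Vm z) - m\<bar> + cmod (p2 Vp Vm z) \<le> c"
      using lead AB by (auto simp: c_def n2_def p2_def A_def B_def)
    moreover have m: "2 * c \<le> m"
    proof -
      have "c * J / (2 * D) \<le> Re z" using x by (simp add: C_def)
      then show ?thesis using D J by (simp add: m_def field_simps)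
    qed
    ultimately have bounds: "(m - c) * sqrt T \<le> L2_norm (Psi Vp Vm z)" "L2_norm (Psi Vp Vm z) \<le> (m + c) * sqrt T"
      using L2_norm_Psi_bounds[OF k(1) l(1)] c unfolding T_def by simp_all
    have T: "sqrt T > 0" using k(1) l(1) by (simp add: T_def add_pos_pos)
    define q where "q = L2_norm (Psi Vp Vm z) / sqrt T"
    have q: "m - c \<le> q" "q \<le> m + c"
      using bounds T by (simp_all add: q_def field_simps)
    have pos: "m > 0" "q > 0" using m c q by linarith+
    have "L2_norm (Psi Vp Vm z) = q * sqrt T" using T by (simp add: q_def)
    then have "L2_norm (\<lambda>x. schroedinger Vp Vm (Psi Vp Vm z) x - z * Psi Vp Vm z x) / L2_norm (Psi Vp Vm z)
         / (J / (2 * D) * (A * B / Re z)) = 2 * A * B * sqrt T / (q * sqrt T) / (J / (2 * D) * (A * B / Re z))"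
      by (simp add: L2_norm_schroedinger_Psi_eq[OF k(1) l(1)] A_def B_def T_def)
    also have "\<dots> = m / q"
      using AB D J T pos x by (simp add: m_def field_simps)
    finally have ratio: "L2_norm (\<lambda>x. schroedinger Vp Vm (Psi Vp Vm z) x - z * Psi Vp Vm z x) / L2_norm (Psi Vp Vm z)
         / (J / (2 * D) * (A * B / Re z)) = m / q" .
    have "\<bar>m / q - 1\<bar> \<le> 2 * c / m"
      using pos(1) m c q by (intro relative_error_le) auto
    also have "\<dots> = C / \<bar>Re z\<bar>"
      using D J x by (simp add: m_def C_def field_simps)
    finally show ?thesis
      unfolding ratio[unfolded A_def B_def] .
  qed
  show "\<exists>M>0. \<exists>C>0. \<forall>z. Re z \<ge> M \<and> Im z \<in> {min (Im Vp) (Im Vm)<..<max (Im Vp) (Im Vm)} \<longrightarrow>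
       \<bar>(L2_norm (\<lambda>x. schroedinger Vp Vm (Psi Vp Vm z) x - z * Psi Vp Vm z x) / L2_norm (Psi Vp Vm z))
         / (cmod (Vp - Vm) / (2 * \<bar>Im Vp - Im Vm\<bar>)
              * (\<bar>Im Vp - Im z\<bar> * \<bar>Im Vm - Im z\<bar> / Re z)) - 1\<bar>
       \<le> C / \<bar>Re z\<bar>"
    using main C unfolding J_def D_def
    by (intro exI[of _ "max 1 C"] exI[of _ C] conjI allI impI) auto
qed

end
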